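(* Let $p>1$, let $(X,\mu)$ be a non-atomic probability space equipped with a tree $\mathcal T$, and let $\mathcal M_{\mathcal T}$ be the associated maximal operator. Let $\phi:X\to[0,\infty)$ be $\mathcal T$-good with $\int_X\phi\,d\mu=f$. Then for every $q\in[1,p]$, $$\int_X(\mathcal M_{\mathcal T}\phi)^p\,d\mu\ \le\ -\frac{q}{p-1}f^p+\left(\frac{p}{p-1}\right)^q\int_X\phi^q(\mathcal M_{\mathcal T}\phi)^{p-q}\,d\mu .$$ Additionally, this inequality is best possible for any given $q\in[1,p]$ and $f>0$, in the following sense: for every $c>\frac{q}{p-1}$ there exists a $\mathcal T$-good $\phi:X\to[0,\infty)$ with $\int_X\phi\,d\mu=f$ for which the inequality $$\int_X(\mathcal M_{\mathcal T}\phi)^p\,d\mu\le -c\,f^p+\left(\frac{p}{p-1}\right)^q\int_X\phi^q(\mathcal M_{\mathcal T}\phi)^{p-q}\,d\mu$$ fails.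
   Context: Tree: a set $\mathcal T$ of measurable subsets of $X$ is called a tree if (i) $X\in\mathcal T$ and $\mu(I)>0$ for every $I\in\mathcal T$; (ii) to every $I\in\mathcal T$ there corresponds a finite or countable subset $C(I)\subseteq\mathcal T$ containing at least two elements, such that the elements of $C(I)$ are pairwise disjoint subsets of $I$ and $I=\bigcup C(I)$; (iii) $\mathcal T=\bigcup_{m\ge0}\mathcal T_{(m)}$, where $\mathcal T_{(0)}=\{X\}$ and $\mathcal T_{(m+1)}=\bigcup_{I\in\mathcal T_{(m)}}C(I)$; (iv) $\lim_{m\to\infty}\sup_{I\in\mathcal T_{(m)}}\mu(I)=0$. Maximal operator: for $\phi\in L^1(X,\mu)$, $\mathcal M_{\mathcal T}\phi(x)=\sup\left\{\frac1{\mu(I)}\int_I|\phi|\,d\mu:\ x\in I\in\mathcal T\right\}$. $\mathcal T$-good: for nonnegative $\phi\in L^1(X,\mu)$ and $I\in\mathcal T$ put $\mathrm{Av}_I(\phi)=\frac1{\mu(I)}\int_I\phi\,d\mu$. The function $\phi$ is called $\mathcal T$-good if the set $\{x\in X:\ \mathcal M_{\mathcal T}\phi(x)>\mathrm{Av}_I(\phi)\text{ for all }I\in\mathcal T\text{ with }x\in I\}$ has $\mu$-measure zero. Integrals of nonnegative functions are taken in $[0,\infty]$. *)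

theory Defs
  imports "HOL-Probability.Probability_Measure"
begin

definition non_atomic :: "'a measure \<Rightarrow> bool" where
  "non_atomic M \<longleftrightarrow>
     (\<forall>A\<in>sets M. 0 < emeasure M A \<longrightarrow>
        (\<exists>B\<in>sets M. B \<subseteq> A \<and> 0 < emeasure M B \<and> emeasure M B < emeasure M A))"

primrec tree_level :: "'a set \<Rightarrow> ('a set \<Rightarrow> 'a set set) \<Rightarrow> nat \<Rightarrow> 'a set set" where
  "tree_level X C 0 = {X}"
| "tree_level X C (Suc m) = (\<Union>I\<in>tree_level X C m. C I)"

definition is_tree :: "'a measure \<Rightarrow> 'a set set \<Rightarrow> bool" where
  "is_tree M T \<longleftrightarrow>
     T \<subseteq> sets M \<and> space M \<in> T \<and> (\<forall>I\<in>T. 0 < emeasure M I) \<and>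
     (\<exists>C. (\<forall>I\<in>T. C I \<subseteq> T \<and> countable (C I) \<and> (\<exists>J\<in>C I. \<exists>K\<in>C I. J \<noteq> K) \<and>
                  disjoint (C I) \<and> (\<forall>J\<in>C I. J \<subseteq> I) \<and> I = \<Union>(C I)) \<and>
          T = (\<Union>m. tree_level (space M) C m) \<and>
          (\<lambda>m. SUP I\<in>tree_level (space M) C m. emeasure M I) \<longlonglongrightarrow> 0)"

definition Av :: "'a measure \<Rightarrow> 'a set \<Rightarrow> ('a \<Rightarrow> real) \<Rightarrow> real" where
  "Av M I \<phi> = (1 / measure M I) * (LINT x:I|M. \<phi> x)"

(* Valued in ennreal because the supremum may be infinite at some points. *)
definition maximal_op :: "'a measure \<Rightarrow> 'a set set \<Rightarrow> ('a \<Rightarrow> real) \<Rightarrow> 'a \<Rightarrow> ennreal" where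
  "maximal_op M T \<phi> x = (SUP I\<in>{I\<in>T. x \<in> I}. ennreal (Av M I (\<lambda>y. \<bar>\<phi> y\<bar>)))"

definition tree_good :: "'a measure \<Rightarrow> 'a set set \<Rightarrow> ('a \<Rightarrow> real) \<Rightarrow> bool" where
  "tree_good M T \<phi> \<longleftrightarrow>
     integrable M \<phi> \<and> (\<forall>x\<in>space M. 0 \<le> \<phi> x) \<and>
     {x\<in>space M. \<forall>I\<in>T. x \<in> I \<longrightarrow> ennreal (Av M I \<phi>) < maximal_op M T \<phi> x} \<in> null_sets M"

(* Power with exponent a >= 0 on [0, infinity], with x^0 = 1 for every x
   (whereas 0 powr 0 = 0) and infinity^a = infinity for a > 0. *)
definition ennreal_rpow :: "ennreal \<Rightarrow> real \<Rightarrow> ennreal" where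
  "ennreal_rpow x a =
     (if a = 0 then 1 else if x = top then top else ennreal (enn2real x powr a))"

end

theory Submission
  imports Defs "HOL-Real_Asymp.Real_Asymp"
begin

text \<open>The set where the maximal function exceeds a level is a disjoint union of tree sets whose averages
  exceed that level. Integrating the resulting weak-type inequality over the levels gives the case
  \<open>q = 1\<close> of the estimate for the truncated maximal function, and Young's inequality (applied
  pointwise, with the power integral of the truncation absorbed on the left) gives every \<open>q\<close>.

  For sharpness, choose inside every tree set a subfamily of one later level of relative measure
  nearly \<open>b\<close>, iterate from the whole space, and let \<open>\<phi>\<close> be constant on each set minus its subfamily, so that
  its average over every set of generation \<open>k\<close> is \<open>f * g ^ k\<close>. Then \<open>\<phi>\<close> is nearly proportional to its
  maximal function, and letting \<open>b\<close> and \<open>g\<close> tend to \<open>1\<close> at suitable rates exhausts the constant.\<close>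

section \<open>Trees of measurable sets\<close>

text \<open>The maximal function is at least \<open>f\<close> everywhere, so the levels are
  integrated only from \<open>f\<close> upwards; the boundary terms at \<open>f\<close> produce the
  negative term of the estimate.

  Equality in the pointwise Young step requires \<open>\<phi>\<close> to be
  \<open>(p - 1) / p\<close> times its maximal function. The model, for \<open>f = 1\<close>, is
  \<open>(1 - s) * x powr (- s)\<close> on the unit interval: its averages over initial intervals
  are \<open>x powr (- s)\<close>, and the \<open>p\<close>-th powers of these have integral
  \<open>1 / (1 - p * s)\<close>. The constant is approached as \<open>s\<close> tends to
  \<open>1 / p\<close> from below. In a tree the initial intervals become the nested selected
  families, with \<open>g = 1 + s * (1 - b)\<close>.

  Two obstacles shape the construction. A tree set need not split in an exact ratio, so the ratios
  range over a window from \<open>b'\<close> to \<open>b\<close>, chosen much narrower than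
  \<open>1 - b\<close>. Goodness asks that the supremum be attained almost everywhere; taking each
  subfamily from a single level leaves only finitely many different averages at almost every
  point.\<close>

locale measure_tree = prob_space M for M :: "'a measure" +
  fixes T :: "'a set set" and C :: "'a set \<Rightarrow> 'a set set"
  assumes tree_sets: "T \<subseteq> sets M"
    and tree_pos: "I \<in> T \<Longrightarrow> 0 < emeasure M I"
    and children_subset: "I \<in> T \<Longrightarrow> C I \<subseteq> T"
    and children_countable: "I \<in> T \<Longrightarrow> countable (C I)"
    and children_disjoint: "I \<in> T \<Longrightarrow> disjoint (C I)"
    and children_Union: "I \<in> T \<Longrightarrow> \<Union>(C I) = I"
    and tree_eq: "T = (\<Union>m. tree_level (space M) C m)"
    and mesh_tendsto_0: "(\<lambda>m. SUP I\<in>tree_level (space M) C m. emeasure M I) \<longlonglongrightarrow> 0"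

lemma is_tree_imp_measure_tree:
  assumes "prob_space M" "is_tree M T"
  obtains C where "measure_tree M T C"
  using assms unfolding is_tree_def measure_tree_def measure_tree_axioms_def by (metis (no_types, lifting))

text \<open>Stated for an arbitrary family \<open>S\<close> closed under a successor map
  \<open>D\<close>, because this and the next two lemmas serve both the tree itself, with
  \<open>C\<close>, and the selected generations, with \<open>G\<close>.\<close>

lemma countable_tree_level:
  assumes "X \<in> S" "\<And>I. I \<in> S \<Longrightarrow> D I \<subseteq> S" "\<And>I. I \<in> S \<Longrightarrow> countable (D I)"
  shows "tree_level X D m \<subseteq> S \<and> countable (tree_level X D m)"
proof (induction m)
  case (Suc m)
  then have "countable (\<Union>(D ` tree_level X D m))"
    using assms(3) by (intro countable_UN) auto
  with Suc show ?case using assms(2) by auto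
qed (use assms in auto)

text \<open>Only the inclusion \<open>\<Union>(D I) \<subseteq> I\<close> is assumed: the selected
  subfamilies do not cover their parent.\<close>

lemma tree_level_refines:
  assumes "X \<in> S" "\<And>I. I \<in> S \<Longrightarrow> D I \<subseteq> S" "\<And>I. I \<in> S \<Longrightarrow> \<Union>(D I) \<subseteq> I"
    and "\<And>I. I \<in> S \<Longrightarrow> countable (D I)"
    and "J \<in> tree_level X D n" "m \<le> n"
  shows "\<exists>I\<in>tree_level X D m. J \<subseteq> I"
  using assms(6,5)
proof (induction n arbitrary: J rule: dec_induct)
  case base
  then show ?case by auto
next
  case (step n)
  then obtain K where K: "K \<in> tree_level X D n" "J \<in> D K" by auto
  then have "K \<in> S" using countable_tree_level[of X S D n, OF assms(1,2,4)] by blast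
  with K assms(3) have "J \<subseteq> K" by blast
  with step.IH[OF K(1)] show ?case by blast
qed

lemma disjoint_tree_level:
  assumes "X \<in> S" "\<And>I. I \<in> S \<Longrightarrow> D I \<subseteq> S" "\<And>I. I \<in> S \<Longrightarrow> \<Union>(D I) \<subseteq> I"
    and "\<And>I. I \<in> S \<Longrightarrow> countable (D I)" "\<And>I. I \<in> S \<Longrightarrow> disjoint (D I)"
  shows "disjoint (tree_level X D m)"
proof (induction m)
  case (Suc m)
  have S: "I \<in> S" if "I \<in> tree_level X D m" for I
    using countable_tree_level[of X S D m, OF assms(1,2,4)] that by blast
  show ?case
  proof (rule disjointI)
    fix A B assume "A \<in> tree_level X D (Suc m)" "B \<in> tree_level X D (Suc m)" and AB: "A \<noteq> B"
    then obtain I J where I: "I \<in> tree_level X D m" "A \<in> D I" and J: "J \<in> tree_level X D m" "B \<in> D J"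
      by auto
    show "A \<inter> B = {}"
    proof (cases "I = J")
      case True
      then show ?thesis using I J AB assms(5)[OF S[OF I(1)]] by (auto dest: disjointD)
    next
      case False
      then have "I \<inter> J = {}" using Suc I J by (auto dest: disjointD)
      then show ?thesis using I J assms(3)[OF S[OF I(1)]] assms(3)[OF S[OF J(1)]] by blast
    qed
  qed
qed auto

context measure_tree
begin

abbreviation level :: "nat \<Rightarrow> 'a set set" where
  "level \<equiv> tree_level (space M) C"

lemma space_in_tree: "space M \<in> T"
proof -
  have "space M \<in> level 0" by simp
  then show ?thesis unfolding tree_eq by blast
qed

lemma tree_subset_space: "I \<in> T \<Longrightarrow> I \<subseteq> space M"
  using tree_sets sets.sets_into_space by blast

lemma tree_measure_pos: "I \<in> T \<Longrightarrow> 0 < measure M I"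
  using tree_pos[of I] by (simp add: emeasure_eq_measure)

lemma level_subset: "level m \<subseteq> T" and countable_level: "countable (level m)"
  using countable_tree_level[of "space M" T C m, OF space_in_tree children_subset children_countable] by auto

lemma countable_tree: "countable T"
  unfolding tree_eq using countable_level by auto

lemma disjoint_level: "disjoint (level m)"
  by (rule disjoint_tree_level[of _ T])
    (use space_in_tree children_subset children_countable children_Union children_disjoint in auto)

lemma level_refines: "J \<in> level n \<Longrightarrow> m \<le> n \<Longrightarrow> \<exists>I\<in>level m. J \<subseteq> I"
  by (rule tree_level_refines[of _ T])
    (use space_in_tree children_subset children_countable children_Union in auto)

lemma Union_level: "\<Union>(level m) = space M"
proof (induction m)
  case (Suc m)
  have "\<Union>(level (Suc m)) = (\<Union>I\<in>level m. \<Union>(C I))" by auto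
  also have "\<dots> = (\<Union>I\<in>level m. I)" using level_subset children_Union by (intro SUP_cong) blast+
  finally show ?case using Suc by simp
qed simp

text \<open>The ancestor of \<open>J\<close> in level \<open>m\<close> meets \<open>I\<close>, and
  sets of one level are disjoint, so this ancestor is \<open>I\<close>.\<close>

lemma level_nested:
  assumes "I \<in> level m" "J \<in> level n" "m \<le> n" "I \<inter> J \<noteq> {}"
  shows "J \<subseteq> I"
proof -
  obtain K where K: "K \<in> level m" "J \<subseteq> K" using level_refines assms by blast
  then have "K \<inter> I \<noteq> {}" using assms by auto
  then have "K = I" using disjoint_level K assms by (meson disjointD)
  with K show ?thesis by simp
qed

lemma tree_nested:
  assumes "I \<in> T" "J \<in> T" "I \<inter> J \<noteq> {}"
  shows "I \<subseteq> J \<or> J \<subseteq> I"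
proof -
  obtain m n where "I \<in> level m" "J \<in> level n" using assms tree_eq by auto
  then show ?thesis using level_nested[of I m J n] level_nested[of J n I m] assms
    by (metis inf_commute nle_le)
qed

lemma maximal_op_measurable [measurable]: "maximal_op M T \<phi> \<in> borel_measurable M"
proof -
  \<comment> \<open>Indicators make the index set independent of \<open>x\<close>; the result is a
    countable supremum of measurable functions.\<close>
  have "maximal_op M T \<phi> = (\<lambda>x. SUP I\<in>T. ennreal (Av M I (\<lambda>y. \<bar>\<phi> y\<bar>)) * indicator I x)"
  proof
    fix x
    have "(SUP I\<in>T. ennreal (Av M I (\<lambda>y. \<bar>\<phi> y\<bar>)) * indicator I x)
      \<le> (SUP I\<in>{I\<in>T. x \<in> I}. ennreal (Av M I (\<lambda>y. \<bar>\<phi> y\<bar>)))"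
      by (rule SUP_least) (auto simp: indicator_def intro!: SUP_upper)
    moreover have "(SUP I\<in>{I\<in>T. x \<in> I}. ennreal (Av M I (\<lambda>y. \<bar>\<phi> y\<bar>)))
      \<le> (SUP I\<in>T. ennreal (Av M I (\<lambda>y. \<bar>\<phi> y\<bar>)) * indicator I x)"
      by (rule SUP_mono) (auto simp: indicator_def intro!: bexI)
    ultimately show "maximal_op M T \<phi> x = (SUP I\<in>T. ennreal (Av M I (\<lambda>y. \<bar>\<phi> y\<bar>)) * indicator I x)"
      unfolding maximal_op_def by (rule antisym[rotated])
  qed
  moreover have "(\<lambda>x. SUP I\<in>T. ennreal (Av M I (\<lambda>y. \<bar>\<phi> y\<bar>)) * indicator I x) \<in> borel_measurable M"
    using countable_tree tree_sets by (intro borel_measurable_SUP) auto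
  ultimately show ?thesis by simp
qed

lemma Av_abs_cong:
  assumes "I \<in> T" "\<And>x. x \<in> space M \<Longrightarrow> 0 \<le> \<phi> x"
  shows "Av M I (\<lambda>y. \<bar>\<phi> y\<bar>) = Av M I \<phi>"
  unfolding Av_def set_lebesgue_integral_def using assms
  by (auto intro!: Bochner_Integration.integral_cong)

text \<open>Clearing the denominator turns an average into the mass of \<open>I\<close> under
  \<open>density M \<phi>\<close>, so comparisons of averages become comparisons of measures and can
  be summed over disjoint families.\<close>

lemma ennreal_Av_mult:
  assumes "I \<in> T" "integrable M \<phi>" "\<And>x. x \<in> space M \<Longrightarrow> 0 \<le> \<phi> x"
  shows "ennreal (Av M I \<phi>) * emeasure M I = (\<integral>\<^sup>+x. ennreal (\<phi> x) * indicator I x \<partial>M)"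
proof -
  have I: "I \<in> sets M" using assms tree_sets by auto
  have eq: "(\<integral>\<^sup>+x. ennreal (\<phi> x) * indicator I x \<partial>M) = ennreal (LINT x:I|M. \<phi> x)"
  proof -
    have "(\<integral>\<^sup>+x. ennreal (\<phi> x) * indicator I x \<partial>M) = (\<integral>\<^sup>+x. ennreal (indicator I x *\<^sub>R \<phi> x) \<partial>M)"
      by (intro nn_integral_cong) (auto simp: indicator_def)
    also have "\<dots> = ennreal (LINT x:I|M. \<phi> x)"
      unfolding set_lebesgue_integral_def
      by (intro nn_integral_eq_integral integrable_mult_indicator I assms)
        (use assms in \<open>auto simp: indicator_def\<close>)
    finally show ?thesis .
  qed
  have "0 \<le> (LINT x:I|M. \<phi> x)"
    unfolding set_lebesgue_integral_def
    by (intro Bochner_Integration.integral_nonneg) (use assms in \<open>auto simp: indicator_def\<close>)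
  then show ?thesis using eq tree_measure_pos[OF assms(1)]
    by (simp add: Av_def emeasure_eq_measure ennreal_mult'[symmetric])
qed

end

text \<open>Countable additivity of both measures. With a density for \<open>N\<close>, a bound on
  the averages over the members of a disjoint family passes to its union.\<close>

lemma emeasure_Union_le_of_disjoint:
  assumes "sets N = sets M" "countable F" "disjoint F" "F \<subseteq> sets M"
    and "\<And>I. I \<in> F \<Longrightarrow> emeasure N I \<le> a * emeasure M I"
  shows "emeasure N (\<Union>F) \<le> a * emeasure M (\<Union>F)"
proof -
  have d: "disjoint_family_on (\<lambda>I. I) F" using assms by (auto simp: disjoint_family_on_def disjoint_def)
  have "emeasure N (\<Union>F) = (\<integral>\<^sup>+I. emeasure N I \<partial>count_space F)"
    using emeasure_UN_countable[of F "\<lambda>I. I" N] d subsetD[OF assms(4)] assms(1,2) by auto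
  also have "\<dots> \<le> (\<integral>\<^sup>+I. a * emeasure M I \<partial>count_space F)"
    by (rule nn_integral_mono) (use assms in auto)
  also have "\<dots> = a * emeasure M (\<Union>F)"
    using emeasure_UN_countable[of F "\<lambda>I. I" M] d subsetD[OF assms(4)] assms(2) by (subst nn_integral_cmult) auto
  finally show ?thesis .
qed

lemma emeasure_Union_ge_of_disjoint:
  assumes "sets N = sets M" "countable F" "disjoint F" "F \<subseteq> sets M"
    and "\<And>I. I \<in> F \<Longrightarrow> a * emeasure M I \<le> emeasure N I"
  shows "a * emeasure M (\<Union>F) \<le> emeasure N (\<Union>F)"
proof -
  have d: "disjoint_family_on (\<lambda>I. I) F" using assms by (auto simp: disjoint_family_on_def disjoint_def)
  have "a * emeasure M (\<Union>F) = (\<integral>\<^sup>+I. a * emeasure M I \<partial>count_space F)"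
    using emeasure_UN_countable[of F "\<lambda>I. I" M] d subsetD[OF assms(4)] assms(2) by (subst nn_integral_cmult) auto
  also have "\<dots> \<le> (\<integral>\<^sup>+I. emeasure N I \<partial>count_space F)"
    by (rule nn_integral_mono) (use assms in auto)
  also have "\<dots> = emeasure N (\<Union>F)"
    using emeasure_UN_countable[of F "\<lambda>I. I" N] d subsetD[OF assms(4)] assms(1,2) by auto
  finally show ?thesis .
qed

section \<open>Weak-type estimate on the superlevel sets\<close>

context measure_tree
begin

text \<open>A stopping argument of Calderon-Zygmund type: the superlevel set is the disjoint union
  of the tree sets at which the average first exceeds \<open>t\<close>. The right-hand integral is
  restricted to the superlevel set itself, which is what makes the sharp constant reachable.\<close>

lemma maximal_op_weak_type:
  assumes "integrable M \<phi>" "\<And>x. x \<in> space M \<Longrightarrow> 0 \<le> \<phi> x"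
  shows "t * emeasure M {x\<in>space M. t < maximal_op M T \<phi> x}
      \<le> (\<integral>\<^sup>+x. ennreal (\<phi> x) * indicator {x\<in>space M. t < maximal_op M T \<phi> x} x \<partial>M)"
proof -
  define E where "E m = {I\<in>level m. t < ennreal (Av M I \<phi>)}" for m
  \<comment> \<open>A set is kept when it meets no set of an earlier level whose average exceeds
    \<open>t\<close>; by nesting, these are the stopping sets.\<close>
  define N where "N = (\<Union>m. {I\<in>E m. \<forall>k<m. \<forall>J\<in>E k. I \<inter> J = {}})"
  have N_T: "N \<subseteq> T" using level_subset unfolding N_def E_def by blast
  have meas[measurable]: "\<phi> \<in> borel_measurable M" using assms by auto
  have "disjoint N"
  proof (rule disjointI)
    fix I J assume "I \<in> N" "J \<in> N" "I \<noteq> J"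
    then obtain m n where I: "I \<in> E m" "\<forall>k<m. \<forall>J\<in>E k. I \<inter> J = {}"
      and J: "J \<in> E n" "\<forall>k<n. \<forall>I\<in>E k. J \<inter> I = {}" unfolding N_def by auto
    consider "m < n" | "n < m" | "m = n" by linarith
    then show "I \<inter> J = {}"
    proof cases
      case 3
      then have "I \<in> level m" "J \<in> level m" using I J by (auto simp: E_def)
      then show ?thesis using disjoint_level \<open>I \<noteq> J\<close> by (meson disjointD)
    qed (use I J in blast)+
  qed
  moreover have UN: "\<Union>N = {x\<in>space M. t < maximal_op M T \<phi> x}"
  proof (intro equalityI subsetI)
    fix x assume "x \<in> \<Union>N"
    then obtain I where I: "I \<in> T" "x \<in> I" "t < ennreal (Av M I \<phi>)"
      using N_T unfolding N_def E_def by auto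
    then have "t < maximal_op M T \<phi> x"
      unfolding maximal_op_def using Av_abs_cong[OF I(1) assms(2)] by (auto simp: less_SUP_iff)
    then show "x \<in> {x\<in>space M. t < maximal_op M T \<phi> x}" using I tree_subset_space by auto
  next
    fix x assume "x \<in> {x\<in>space M. t < maximal_op M T \<phi> x}"
    then obtain I where I: "I \<in> T" "x \<in> I" "t < ennreal (Av M I (\<lambda>y. \<bar>\<phi> y\<bar>))"
      unfolding maximal_op_def by (auto simp: less_SUP_iff)
    then obtain m where "I \<in> E m"
      using Av_abs_cong[OF I(1) assms(2)] tree_eq unfolding E_def by auto
    then have ex: "\<exists>m. \<exists>I\<in>E m. x \<in> I" using I by auto
    \<comment> \<open>The first level with a large average around \<open>x\<close>. A set of an
      earlier \<open>E k\<close> meeting \<open>K\<close> would contain \<open>K\<close>, hence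
      \<open>x\<close>, against minimality.\<close>
    define n where "n = (LEAST m. \<exists>I\<in>E m. x \<in> I)"
    obtain K where K: "K \<in> E n" "x \<in> K" using LeastI_ex[OF ex] unfolding n_def by auto
    have "K \<inter> J = {}" if "k < n" "J \<in> E k" for k J
    proof (rule ccontr)
      assume "K \<inter> J \<noteq> {}"
      then have "K \<subseteq> J" using level_nested[of J k K n] K that by (auto simp: E_def)
      then show False using not_less_Least[of k "\<lambda>m. \<exists>I\<in>E m. x \<in> I"] that K unfolding n_def by auto
    qed
    then show "x \<in> \<Union>N" using K unfolding N_def by blast
  qed
  moreover have "t * emeasure M I \<le> emeasure (density M \<phi>) I" if "I \<in> N" for I
  proof -
    have IT: "I \<in> T" using that N_T by auto
    then have "t * emeasure M I \<le> ennreal (Av M I \<phi>) * emeasure M I"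
      using that by (intro mult_right_mono) (auto simp: N_def E_def)
    also have "\<dots> = emeasure (density M \<phi>) I"
      using ennreal_Av_mult[OF IT assms] IT tree_sets by (auto simp: emeasure_density)
    finally show ?thesis .
  qed
  ultimately have "t * emeasure M (\<Union>N) \<le> emeasure (density M \<phi>) (\<Union>N)"
    using N_T tree_sets countable_subset[OF N_T countable_tree]
    by (intro emeasure_Union_ge_of_disjoint) auto
  then show ?thesis unfolding UN by (simp add: emeasure_density)
qed

end

section \<open>The maximal inequality\<close>

text \<open>The factor \<open>b\<close> is carried along so that the lemma matches both kernels of
  the layer-cake argument, \<open>b = 1\<close> with \<open>a = p\<close> and
  \<open>b = p / (p - 1)\<close> with \<open>a = p - 1\<close>. For negative \<open>b\<close> both
  sides are 0 because \<open>ennreal\<close> truncates.\<close>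

lemma powr_diff_eq_nn_integral:
  assumes "0 < f" "f \<le> y" "0 < a"
  shows "(\<integral>\<^sup>+t. ennreal (b * (a * t powr (a - 1))) * indicator {f..} t * indicator {t. t < y} t \<partial>lborel)
    = ennreal (b * (y powr a - f powr a))"
proof -
  have "(\<integral>\<^sup>+t. ennreal (a * t powr (a - 1)) * indicator {f..} t * indicator {t. t < y} t \<partial>lborel)
    = (\<integral>\<^sup>+t. ennreal (a * t powr (a - 1)) * indicator {f..y} t \<partial>lborel)"
    using AE_lborel_singleton[of y]
    by (intro nn_integral_cong_AE) (auto simp: indicator_def elim!: eventually_mono)
  also have "\<dots> = ennreal (y powr a - f powr a)"
    using assms by (intro nn_integral_FTC_Icc) (auto intro!: derivative_eq_intros)
  finally have *: "(\<integral>\<^sup>+t. ennreal (a * t powr (a - 1)) * indicator {f..} t * indicator {t. t < y} t \<partial>lborel)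
    = ennreal (y powr a - f powr a)" .
  show ?thesis
  proof (cases "0 \<le> b")
    case True
    have "(\<integral>\<^sup>+t. ennreal (b * (a * t powr (a - 1))) * indicator {f..} t * indicator {t. t < y} t \<partial>lborel)
      = (\<integral>\<^sup>+t. ennreal b * (ennreal (a * t powr (a - 1)) * indicator {f..} t * indicator {t. t < y} t) \<partial>lborel)"
      using True assms by (intro nn_integral_cong) (simp add: ennreal_mult mult.assoc)
    also have "\<dots> = ennreal (b * (y powr a - f powr a))"
      using True assms by (subst nn_integral_cmult) (simp_all add: * ennreal_mult[symmetric] powr_mono2 del: mult_eq_0_iff)
    finally show ?thesis .
  next
    case False
    then show ?thesis using assms by (auto simp: ennreal_neg mult_nonpos_nonneg powr_mono2)
  qed
qed

lemma (in sigma_finite_measure) nn_integral_layer_cake: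
  fixes Y :: "'a \<Rightarrow> real" and g :: "real \<Rightarrow> ennreal"
  assumes [measurable]: "w \<in> borel_measurable M" "Y \<in> borel_measurable M" "g \<in> borel_measurable borel"
  shows "(\<integral>\<^sup>+x. w x * (\<integral>\<^sup>+t. g t * indicator {t. t < Y x} t \<partial>lborel) \<partial>M)
    = (\<integral>\<^sup>+t. g t * (\<integral>\<^sup>+x. w x * indicator {x\<in>space M. t < Y x} x \<partial>M) \<partial>lborel)"
proof -
  interpret pair_sigma_finite M lborel ..
  have "(\<integral>\<^sup>+x. w x * (\<integral>\<^sup>+t. g t * indicator {t. t < Y x} t \<partial>lborel) \<partial>M)
    = (\<integral>\<^sup>+x. \<integral>\<^sup>+t. w x * g t * indicator {z. snd z < Y (fst z)} (x, t) \<partial>lborel \<partial>M)"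
    by (simp add: nn_integral_cmult[symmetric] mult.assoc indicator_def)
  also have "\<dots> = (\<integral>\<^sup>+t. \<integral>\<^sup>+x. w x * g t * indicator {z. snd z < Y (fst z)} (x, t) \<partial>M \<partial>lborel)"
    by (intro Fubini'[symmetric]) measurable
  also have "\<dots> = (\<integral>\<^sup>+t. g t * (\<integral>\<^sup>+x. w x * indicator {x\<in>space M. t < Y x} x \<partial>M) \<partial>lborel)"
    by (subst nn_integral_cmult[symmetric])
      (auto intro!: nn_integral_cong simp: indicator_def mult_ac)
  finally show ?thesis .
qed

lemma le_of_ennreal_le: "ennreal a \<le> ennreal b \<Longrightarrow> 0 \<le> b \<Longrightarrow> a \<le> b"
  using ennreal_le_iff by blast

text \<open>Layer cake on both sides: the integral of \<open>Y powr p - f powr p\<close> is that of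
  \<open>p * t powr (p - 1)\<close> against the measure of \<open>Y > t\<close>, over
  \<open>t \<ge> f\<close>. The weak-type bound trades one factor \<open>t\<close> for
  \<open>\<phi>\<close>, and integrating back gives \<open>p / (p - 1)\<close> times the integral of
  \<open>\<phi> * (Y powr (p - 1) - f powr (p - 1))\<close>. The bound \<open>N\<close> keeps all
  integrals finite, so that real subtraction is legitimate.\<close>

lemma (in prob_space) integral_powr_le_of_weak_type:
  fixes Y \<phi> :: "'a \<Rightarrow> real"
  assumes [measurable]: "Y \<in> borel_measurable M" and int: "integrable M \<phi>"
    and pos: "\<And>x. x \<in> space M \<Longrightarrow> 0 \<le> \<phi> x"
    and Y: "\<And>x. x \<in> space M \<Longrightarrow> f \<le> Y x" "\<And>x. x \<in> space M \<Longrightarrow> Y x \<le> N"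
    and f: "0 < f" "(LINT x|M. \<phi> x) = f" and p: "1 < p"
    and weak: "\<And>t. f \<le> t \<Longrightarrow> ennreal t * emeasure M {x\<in>space M. t < Y x}
      \<le> (\<integral>\<^sup>+x. ennreal (\<phi> x) * indicator {x\<in>space M. t < Y x} x \<partial>M)"
  shows "(LINT x|M. Y x powr p) \<le> - (1 / (p - 1) * f powr p) + p / (p - 1) * (LINT x|M. \<phi> x * Y x powr (p - 1))"
    and "integrable M (\<lambda>x. Y x powr p)"
    and "integrable M (\<lambda>x. \<phi> x * Y x powr (p - 1))"
proof -
  have [measurable]: "\<phi> \<in> borel_measurable M" using int by auto
  have Ypos: "0 < Y x" if "x \<in> space M" for x using Y(1)[OF that] f(1) by linarith
  show intY: "integrable M (\<lambda>x. Y x powr p)"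
  proof (rule integrable_const_bound[where B="N powr p"])
    show "AE x in M. norm (Y x powr p) \<le> N powr p"
      using Y Ypos p by (intro AE_I2) (auto intro!: powr_mono2 simp: less_imp_le)
  qed measurable
  show intP: "integrable M (\<lambda>x. \<phi> x * Y x powr (p - 1))"
  proof (rule Bochner_Integration.integrable_bound[where f="\<lambda>x. \<phi> x * N powr (p - 1)"])
    show "AE x in M. norm (\<phi> x * Y x powr (p - 1)) \<le> norm (\<phi> x * N powr (p - 1))"
      using Y Ypos p pos
      by (intro AE_I2) (auto intro!: powr_mono2 mult_left_mono simp: less_imp_le abs_mult)
  qed (use int in auto)
  have pw: "f powr a \<le> Y x powr a" if "x \<in> space M" "0 \<le> a" for x a
    using Y(1)[OF that(1)] f that(2) by (intro powr_mono2) auto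
  have nn: "0 \<le> p / (p - 1) * (\<phi> x * Y x powr (p - 1)) - p / (p - 1) * f powr (p - 1) * \<phi> x"
    if x: "x \<in> space M" for x
  proof -
    have "0 \<le> p / (p - 1) * \<phi> x * (Y x powr (p - 1) - f powr (p - 1))"
      using pw[OF x, of "p - 1"] p pos[OF x] by simp
    then show ?thesis by (simp add: algebra_simps)
  qed
  have "ennreal (LINT x|M. Y x powr p - f powr p) = (\<integral>\<^sup>+x. ennreal (Y x powr p - f powr p) \<partial>M)"
    using intY pw p by (intro nn_integral_eq_integral[symmetric] AE_I2) auto
  also have "\<dots> = (\<integral>\<^sup>+x. 1 * (\<integral>\<^sup>+t. ennreal (1 * (p * t powr (p - 1))) * indicator {f..} t
      * indicator {t. t < Y x} t \<partial>lborel) \<partial>M)"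
    using f Y p by (intro nn_integral_cong) (subst powr_diff_eq_nn_integral, auto)
  also have "\<dots> = (\<integral>\<^sup>+t. ennreal (1 * (p * t powr (p - 1))) * indicator {f..} t
      * (\<integral>\<^sup>+x. 1 * indicator {x\<in>space M. t < Y x} x \<partial>M) \<partial>lborel)"
    by (rule nn_integral_layer_cake) measurable
  also have "\<dots> \<le> (\<integral>\<^sup>+t. ennreal (p / (p - 1) * ((p - 1) * t powr (p - 1 - 1))) * indicator {f..} t
      * (\<integral>\<^sup>+x. ennreal (\<phi> x) * indicator {x\<in>space M. t < Y x} x \<partial>M) \<partial>lborel)"
  proof (intro nn_integral_mono)
    fix t :: real
    show "ennreal (1 * (p * t powr (p - 1))) * indicator {f..} t
        * (\<integral>\<^sup>+x. 1 * indicator {x\<in>space M. t < Y x} x \<partial>M)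
      \<le> ennreal (p / (p - 1) * ((p - 1) * t powr (p - 1 - 1))) * indicator {f..} t
        * (\<integral>\<^sup>+x. ennreal (\<phi> x) * indicator {x\<in>space M. t < Y x} x \<partial>M)"
    proof (cases "f \<le> t")
      case True
      then have t: "0 < t" using f by auto
      \<comment> \<open>One factor \<open>t\<close> is split off to be consumed by the weak-type
        inequality.\<close>
      have "t powr (p - 1) = t powr (p - 1 - 1) * t"
        using t powr_mult_base[of t "p - 2"] by (simp add: mult.commute)
      then have "ennreal (1 * (p * t powr (p - 1)))
          = ennreal (p / (p - 1) * ((p - 1) * t powr (p - 1 - 1))) * ennreal t"
        using t p by (simp add: ennreal_mult'[symmetric])
      then show ?thesis using True weak[OF True]
        by (simp add: mult.assoc mult_left_mono)
    qed auto
  qed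
  also have "\<dots> = (\<integral>\<^sup>+x. ennreal (\<phi> x) * (\<integral>\<^sup>+t. ennreal (p / (p - 1) * ((p - 1) * t powr (p - 1 - 1)))
      * indicator {f..} t * indicator {t. t < Y x} t \<partial>lborel) \<partial>M)"
    by (rule nn_integral_layer_cake[symmetric]) measurable
  also have "\<dots> = (\<integral>\<^sup>+x. ennreal (p / (p - 1) * (\<phi> x * Y x powr (p - 1)) - p / (p - 1) * f powr (p - 1) * \<phi> x) \<partial>M)"
    using f Y p pos by (intro nn_integral_cong, subst powr_diff_eq_nn_integral)
      (auto simp: ennreal_mult'[symmetric] algebra_simps)
  also have "\<dots> = ennreal (LINT x|M. p / (p - 1) * (\<phi> x * Y x powr (p - 1)) - p / (p - 1) * f powr (p - 1) * \<phi> x)"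
    using intP int nn by (intro nn_integral_eq_integral AE_I2) auto
  finally have "(LINT x|M. Y x powr p - f powr p)
    \<le> (LINT x|M. p / (p - 1) * (\<phi> x * Y x powr (p - 1)) - p / (p - 1) * f powr (p - 1) * \<phi> x)"
    by (rule le_of_ennreal_le) (intro Bochner_Integration.integral_nonneg nn)
  also have "\<dots> = p / (p - 1) * (LINT x|M. \<phi> x * Y x powr (p - 1)) - p / (p - 1) * f powr (p - 1) * f"
    using intP int f by simp
  \<comment> \<open>The boundary terms combine through
    \<open>1 - p / (p - 1) = - 1 / (p - 1)\<close>, the negative coefficient of the
    estimate.\<close>
  also have "p / (p - 1) * f powr (p - 1) * f = f powr p + 1 / (p - 1) * f powr p"
  proof -
    have "f powr (p - 1) * f = f powr p" using f by (simp add: powr_diff)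
    moreover have "p / (p - 1) = 1 + 1 / (p - 1)" using p by (simp add: field_simps)
    ultimately show ?thesis by (simp only: mult.assoc) (simp add: distrib_right)
  qed
  finally show "(LINT x|M. Y x powr p) \<le> - (1 / (p - 1) * f powr p) + p / (p - 1) * (LINT x|M. \<phi> x * Y x powr (p - 1))"
    using intY by (simp add: prob_space)
qed

section \<open>Young's inequality and powers on the extended half-line\<close>

lemma powr_Bernoulli:
  fixes w q :: real
  assumes "0 \<le> w" "1 \<le> q"
  shows "q * w \<le> w powr q + (q - 1)"
proof (cases "q = 1")
  case False
  then have q: "1 < q" using assms by simp
  \<comment> \<open>Young's inequality with second factor 1 yields the tangent line of
    \<open>w powr q\<close> at \<open>w = 1\<close>; the conjugate exponent exists only for
    \<open>q > 1\<close>.\<close>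
  have "1 < q / (q - 1)" "1 / q + 1 / (q / (q - 1)) = 1" using q by (auto simp: field_simps)
  then have "w * 1 \<le> w powr q / q + 1 powr (q / (q - 1)) / (q / (q - 1))"
    using q assms by (intro Youngs_inequality) auto
  then have "q * w \<le> q * (w powr q / q + (q - 1) / q)"
    using q by (intro mult_left_mono) auto
  then show ?thesis using q by (simp add: distrib_left)
qed (use assms in auto)

text \<open>The tangent-line inequality at \<open>w = p / (p - 1) * a / y\<close>, multiplied by
  \<open>y powr p\<close>. Equality holds at \<open>w = 1\<close>, that is
  \<open>a = (p - 1) / p * y\<close>, the ratio at which the extremal functions aim.\<close>

lemma powr_Young:
  fixes a y p q :: real
  assumes "0 \<le> a" "0 < y" "1 < p" "1 \<le> q"
  shows "q * (p / (p - 1) * (a * y powr (p - 1)))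
    \<le> (p / (p - 1)) powr q * (a powr q * y powr (p - q)) + (q - 1) * y powr p"
proof -
  have "q * (p / (p - 1) * a / y) \<le> (p / (p - 1) * a / y) powr q + (q - 1)"
    using assms by (intro powr_Bernoulli) auto
  then have "q * (p / (p - 1) * a / y) * y powr p
    \<le> ((p / (p - 1) * a / y) powr q + (q - 1)) * y powr p"
    by (intro mult_right_mono) auto
  moreover have "q * (p / (p - 1) * a / y) * y powr p = q * (p / (p - 1) * (a * y powr (p - 1)))"
    using assms by (simp add: powr_diff)
  moreover have "((p / (p - 1) * a / y) powr q + (q - 1)) * y powr p
    = (p / (p - 1)) powr q * (a powr q * y powr (p - q)) + (q - 1) * y powr p"
  proof -
    have "(p / (p - 1) * a / y) powr q = (p / (p - 1)) powr q * a powr q / y powr q"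
      using assms by (simp only: powr_mult powr_divide mult_nonneg_nonneg divide_nonneg_nonneg less_imp_le)
    then show ?thesis using assms by (simp add: powr_diff algebra_simps)
  qed
  ultimately show ?thesis by simp
qed

lemma ennreal_rpow_ennreal: "0 < y \<Longrightarrow> ennreal_rpow (ennreal y) a = ennreal (y powr a)"
  by (simp add: ennreal_rpow_def)

lemma ennreal_rpow_mono:
  assumes "x \<le> y" "0 \<le> a"
  shows "ennreal_rpow x a \<le> ennreal_rpow y a"
proof (cases "a = 0 \<or> y = top")
  case True
  then show ?thesis by (auto simp: ennreal_rpow_def)
next
  case False
  then have "x \<noteq> top" "enn2real x \<le> enn2real y" using assms
    by (auto simp: enn2real_mono less_top neq_top_trans)
  with False assms show ?thesis
    by (auto simp: ennreal_rpow_def intro!: ennreal_leI powr_mono2)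
qed

lemma ennreal_rpow_measurable [measurable]: "(\<lambda>x. ennreal_rpow x a) \<in> borel_measurable borel"
  unfolding ennreal_rpow_def by measurable

lemma ennreal_rpow_eq_SUP:
  assumes "0 < a"
  shows "ennreal_rpow x a = (SUP n::nat. ennreal_rpow (min x (ennreal n)) a)"
proof (rule antisym)
  show "(SUP n::nat. ennreal_rpow (min x (ennreal n)) a) \<le> ennreal_rpow x a"
    using assms by (intro SUP_least ennreal_rpow_mono) auto
  show "ennreal_rpow x a \<le> (SUP n::nat. ennreal_rpow (min x (ennreal n)) a)"
  proof (cases x)
    case (real r)
    obtain n where "r \<le> real n" using real_arch_simple by blast
    then have "min x (ennreal n) = x" using real by (simp add: min_def ennreal_leI)
    then show ?thesis
      using SUP_upper[of n UNIV "\<lambda>n. ennreal_rpow (min x (ennreal (real n))) a"] by simp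
  next
    case top
    have "(SUP n::nat. ennreal_rpow (min x (ennreal n)) a) = top"
    proof (rule ennreal_SUP_eq_top)
      fix m :: nat
      \<comment> \<open>The summand 1 keeps \<open>n\<close> positive when \<open>m = 0\<close>, as
        the evaluation of \<open>ennreal_rpow\<close> requires.\<close>
      obtain n where n: "real m powr (1 / a) + 1 \<le> real n" using real_arch_simple by blast
      have "real m = (real m powr (1 / a)) powr a" using assms by (simp add: powr_powr)
      also have "\<dots> \<le> real n powr a" using assms n by (intro powr_mono2) auto
      finally have "of_nat m \<le> ennreal (real n powr a)"
        by (simp add: ennreal_leI ennreal_of_nat_eq_real_of_nat)
      moreover have "0 < real n" using n by (smt (verit) powr_ge_zero)
      ultimately show "\<exists>n\<in>UNIV. of_nat m \<le> ennreal_rpow (min x (ennreal (real n))) a"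
        using top by (intro bexI[of _ n]) (simp_all add: ennreal_rpow_ennreal)
    qed
    then show ?thesis by (simp only: top_greatest)
  qed
qed

section \<open>From the truncated to the full maximal function\<close>

context measure_tree
begin

lemma Av_le_maximal_op:
  assumes "I \<in> T" "x \<in> I" "\<And>x. x \<in> space M \<Longrightarrow> 0 \<le> \<phi> x"
  shows "ennreal (Av M I \<phi>) \<le> maximal_op M T \<phi> x"
  using SUP_upper[of I "{I\<in>T. x \<in> I}" "\<lambda>I. ennreal (Av M I (\<lambda>y. \<bar>\<phi> y\<bar>))"]
    Av_abs_cong[OF assms(1,3)] assms(1,2)
  unfolding maximal_op_def by simp

lemma Av_space: "Av M (space M) \<phi> = (LINT x|M. \<phi> x)"
  by (simp add: Av_def prob_space set_integral_space set_lebesgue_integral_def indicator_def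
      cong: Bochner_Integration.integral_cong)

text \<open>Truncation at \<open>N \<ge> f\<close> preserves the weak-type bound: superlevel sets
  are unchanged for \<open>t < N\<close> and empty for \<open>t \<ge> N\<close>. The case
  \<open>q = 1\<close> is multiplied by \<open>q\<close> and combined with
  \<open>powr_Young\<close>. Since \<open>p - q \<ge> 0\<close>, the truncated mixed integral is at
  most \<open>R\<close>.\<close>

lemma nn_integral_maximal_op_truncated:
  assumes int: "integrable M \<phi>" and pos: "\<And>x. x \<in> space M \<Longrightarrow> 0 \<le> \<phi> x"
    and f: "(LINT x|M. \<phi> x) = f" "0 < f" and p: "1 < p" and q: "1 \<le> q" "q \<le> p"
    and R: "(\<integral>\<^sup>+x. ennreal (\<phi> x powr q) * ennreal_rpow (maximal_op M T \<phi> x) (p - q) \<partial>M) = ennreal R"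
      "0 \<le> R"
    and N: "f \<le> N"
  shows "(\<integral>\<^sup>+x. ennreal_rpow (min (maximal_op M T \<phi> x) (ennreal N)) p \<partial>M)
    \<le> ennreal (- (q / (p - 1) * f powr p) + (p / (p - 1)) powr q * R)"
proof -
  have [measurable]: "\<phi> \<in> borel_measurable M" using int by auto
  define Y where "Y x = enn2real (min (maximal_op M T \<phi> x) (ennreal N))" for x
  have [measurable]: "Y \<in> borel_measurable M" unfolding Y_def by measurable
  have ennY: "ennreal (Y x) = min (maximal_op M T \<phi> x) (ennreal N)" for x
    unfolding Y_def by (simp add: min.strict_coboundedI2)
  have Yge: "f \<le> Y x" if "x \<in> space M" for x
  proof -
    have "ennreal f \<le> ennreal (Y x)" unfolding ennY
      using Av_le_maximal_op[OF space_in_tree that pos] N f by (auto simp: Av_space ennreal_leI)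
    moreover have "0 \<le> Y x" by (simp add: Y_def)
    ultimately show ?thesis by (rule le_of_ennreal_le)
  qed
  have Yle: "Y x \<le> N" for x
    by (rule le_of_ennreal_le) (use f N in \<open>simp_all add: ennY\<close>)
  have weak: "ennreal t * emeasure M {x\<in>space M. t < Y x}
      \<le> (\<integral>\<^sup>+x. ennreal (\<phi> x) * indicator {x\<in>space M. t < Y x} x \<partial>M)" if "f \<le> t" for t
  proof (cases "t < N")
    case True
    have "t < Y x \<longleftrightarrow> ennreal t < maximal_op M T \<phi> x" for x
    proof -
      have "t < Y x \<longleftrightarrow> ennreal t < ennreal (Y x)" using that f by (subst ennreal_less_iff) auto
      then show ?thesis unfolding ennY using True that f by (simp add: ennreal_less_iff)
    qed
    then show ?thesis using maximal_op_weak_type[OF int pos, of "ennreal t"] by simp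
  next
    case False
    then have "Y x \<le> t" for x using Yle[of x] by linarith
    then have empty: "{x\<in>space M. t < Y x} = {}" by (auto simp: not_less)
    show ?thesis unfolding empty by simp
  qed
  note layer = integral_powr_le_of_weak_type[of Y \<phi> f N p, OF _ int pos Yge Yle f(2,1) p weak]
  have Ypos: "0 < Y x" if "x \<in> space M" for x using Yge[OF that] f by simp
  have le: "(\<integral>\<^sup>+x. ennreal (\<phi> x powr q * Y x powr (p - q)) \<partial>M) \<le> ennreal R"
    unfolding R(1)[symmetric]
  proof (intro nn_integral_mono)
    fix x assume x: "x \<in> space M"
    have "ennreal (Y x powr (p - q)) = ennreal_rpow (ennreal (Y x)) (p - q)"
      using Ypos[OF x] by (simp add: ennreal_rpow_ennreal)
    also have "\<dots> \<le> ennreal_rpow (maximal_op M T \<phi> x) (p - q)"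
      unfolding ennY using q by (intro ennreal_rpow_mono) auto
    finally show "ennreal (\<phi> x powr q * Y x powr (p - q))
      \<le> ennreal (\<phi> x powr q) * ennreal_rpow (maximal_op M T \<phi> x) (p - q)"
      by (simp add: ennreal_mult mult_left_mono)
  qed
  have intQ: "integrable M (\<lambda>x. \<phi> x powr q * Y x powr (p - q))"
    by (rule integrableI_bounded) (use le in \<open>auto simp: less_top[symmetric] top_unique\<close>)
  have leQ: "(LINT x|M. \<phi> x powr q * Y x powr (p - q)) \<le> R"
    using le R(2) by (subst (asm) nn_integral_eq_integral[OF intQ]) auto
  have "(LINT x|M. q * (p / (p - 1) * (\<phi> x * Y x powr (p - 1))))
    \<le> (LINT x|M. (p / (p - 1)) powr q * (\<phi> x powr q * Y x powr (p - q)) + (q - 1) * Y x powr p)"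
    using layer(2,3) intQ pos Ypos p q
    by (intro integral_mono powr_Young) auto
  then have young: "q * (p / (p - 1) * (LINT x|M. \<phi> x * Y x powr (p - 1)))
    \<le> (p / (p - 1)) powr q * (LINT x|M. \<phi> x powr q * Y x powr (p - q)) + (q - 1) * (LINT x|M. Y x powr p)"
    using layer(2,3) intQ by simp
  have "q * (LINT x|M. Y x powr p)
    \<le> q * (- (1 / (p - 1) * f powr p) + p / (p - 1) * (LINT x|M. \<phi> x * Y x powr (p - 1)))"
    using layer(1) q by (intro mult_left_mono) auto
  also have "\<dots> = - (q / (p - 1) * f powr p) + q * (p / (p - 1) * (LINT x|M. \<phi> x * Y x powr (p - 1)))"
    by (simp add: algebra_simps)
  also have "\<dots> \<le> - (q / (p - 1) * f powr p) + ((p / (p - 1)) powr q * R + (q - 1) * (LINT x|M. Y x powr p))"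
    using young mult_left_mono[OF leQ, of "(p / (p - 1)) powr q"] by simp
  \<comment> \<open>Subtracting \<open>q - 1\<close> copies of the power integral from the
    \<open>q\<close> copies on the left is allowed because the truncated integral is finite.\<close>
  finally have *: "(LINT x|M. Y x powr p) \<le> - (q / (p - 1) * f powr p) + (p / (p - 1)) powr q * R"
    by (simp add: algebra_simps)
  have "(\<integral>\<^sup>+x. ennreal_rpow (min (maximal_op M T \<phi> x) (ennreal N)) p \<partial>M) = (\<integral>\<^sup>+x. ennreal (Y x powr p) \<partial>M)"
    unfolding ennY[symmetric] using Ypos by (intro nn_integral_cong) (simp add: ennreal_rpow_ennreal)
  also have "\<dots> = ennreal (LINT x|M. Y x powr p)"
    using layer(2) by (intro nn_integral_eq_integral) auto
  finally show ?thesis using * by (simp add: ennreal_leI)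
qed

text \<open>If \<open>f = 0\<close>, all averages and hence the maximal function vanish; if the
  mixed integral is infinite, so is the right-hand side. Otherwise the truncated bounds are uniform
  and monotone convergence removes the truncation.\<close>

lemma nn_integral_maximal_op_le:
  assumes int: "integrable M \<phi>" and pos: "\<And>x. x \<in> space M \<Longrightarrow> 0 \<le> \<phi> x"
    and f: "(LINT x|M. \<phi> x) = f" and p: "1 < p" and q: "1 \<le> q" "q \<le> p"
  shows "enn2ereal (\<integral>\<^sup>+x. ennreal_rpow (maximal_op M T \<phi> x) p \<partial>M)
           \<le> - ereal (q / (p - 1) * f powr p)
             + ereal ((p / (p - 1)) powr q)
               * enn2ereal (\<integral>\<^sup>+x. ennreal (\<phi> x powr q)
                                 * ennreal_rpow (maximal_op M T \<phi> x) (p - q) \<partial>M)"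
    (is "enn2ereal ?L \<le> _ + _ * enn2ereal ?R")
proof -
  have [measurable]: "\<phi> \<in> borel_measurable M" using int by auto
  have "0 \<le> f" using f pos by (auto intro!: Bochner_Integration.integral_nonneg)
  then consider "f = 0" | "0 < f" "?R = top" | "0 < f" "?R \<noteq> top" by linarith
  then show ?thesis
  proof cases
    case 1
    have "AE x in M. \<phi> x = 0"
      using integral_nonneg_eq_0_iff_AE[OF int] f pos 1 by auto
    then have "Av M I \<phi> = 0" if "I \<in> T" for I
    proof -
      have "(LINT x:I|M. \<phi> x) = (LINT x|M. 0)"
        unfolding set_lebesgue_integral_def using that tree_sets \<open>AE x in M. \<phi> x = 0\<close>
        by (intro integral_cong_AE) (auto simp: indicator_def)
      then show ?thesis by (simp add: Av_def)
    qed
    then have "maximal_op M T \<phi> x = 0" for x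
      unfolding maximal_op_def using Av_abs_cong pos by (auto intro!: antisym[OF SUP_least])
    then have "?L = 0" using p by (simp add: ennreal_rpow_def)
    then show ?thesis using 1 by (simp add: zero_ennreal.rep_eq enn2ereal_nonneg)
  next
    case 2
    then show ?thesis using p by simp
  next
    case 3
    then obtain R where R: "?R = ennreal R" "0 \<le> R" by (cases ?R) auto
    define B where "B = - (q / (p - 1) * f powr p) + (p / (p - 1)) powr q * R"
    have le: "(\<integral>\<^sup>+x. ennreal_rpow (min (maximal_op M T \<phi> x) (ennreal N)) p \<partial>M) \<le> ennreal B"
      if "f \<le> N" for N
      unfolding B_def using nn_integral_maximal_op_truncated[OF int pos f 3(1) p q R that] by simp
    have "?L = (\<integral>\<^sup>+x. (SUP n::nat. ennreal_rpow (min (maximal_op M T \<phi> x) (ennreal n)) p) \<partial>M)"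
      using p by (intro nn_integral_cong ennreal_rpow_eq_SUP) auto
    also have "\<dots> = (SUP n::nat. \<integral>\<^sup>+x. ennreal_rpow (min (maximal_op M T \<phi> x) (ennreal n)) p \<partial>M)"
    proof (rule nn_integral_monotone_convergence_SUP)
      show "incseq (\<lambda>n x. ennreal_rpow (min (maximal_op M T \<phi> x) (ennreal (real n))) p)"
        using p by (intro incseq_SucI le_funI ennreal_rpow_mono) (auto simp: min.coboundedI2 ennreal_leI)
    qed measurable
    also have "\<dots> \<le> ennreal B"
    proof (rule SUP_least)
      fix n :: nat
      have "(\<integral>\<^sup>+x. ennreal_rpow (min (maximal_op M T \<phi> x) (ennreal n)) p \<partial>M)
        \<le> (\<integral>\<^sup>+x. ennreal_rpow (min (maximal_op M T \<phi> x) (ennreal (max f n))) p \<partial>M)"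
        using p by (intro nn_integral_mono ennreal_rpow_mono min.mono order_refl ennreal_leI) auto
      also have "\<dots> \<le> ennreal B" by (rule le) simp
      finally show "(\<integral>\<^sup>+x. ennreal_rpow (min (maximal_op M T \<phi> x) (ennreal n)) p \<partial>M) \<le> ennreal B" .
    qed
    finally have L: "?L \<le> ennreal B" .
    \<comment> \<open>A bound by \<open>ennreal B\<close> says nothing about the sign of
      \<open>B\<close>, since negative reals are sent to 0. The lower bound \<open>f powr p\<close>
      on the left-hand side excludes a negative \<open>B\<close>.\<close>
    have "0 < ennreal (f powr p)" using 3 by simp
    also have "ennreal (f powr p) = (\<integral>\<^sup>+x. ennreal_rpow (ennreal f) p \<partial>M)"
      using 3 by (simp add: ennreal_rpow_ennreal emeasure_space_1)
    also have "\<dots> \<le> ?L"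
      using Av_le_maximal_op[OF space_in_tree _ pos] f p
      by (intro nn_integral_mono ennreal_rpow_mono) (auto simp: Av_space)
    finally have "0 < ennreal B" using L by (rule less_le_trans)
    then have "0 \<le> B" by simp
    then have "enn2ereal ?L \<le> ereal B" using L by (simp add: less_eq_ennreal.rep_eq enn2ereal_ennreal)
    then show ?thesis using R by (simp add: B_def enn2ereal_ennreal)
  qed
qed

end

section \<open>Choice of the parameters\<close>

text \<open>Substituting \<open>s = 1 / p - d\<close> turns the quotient of the two sides into a
  difference quotient at 1 of the \<open>q\<close>-th power, with limit \<open>q / (p - 1)\<close>
  as \<open>d\<close> tends to 0.\<close>

lemma ex_exponent:
  fixes p q c :: real
  assumes p: "1 < p" and q: "1 \<le> q" and c: "q / (p - 1) < c"
  obtains s where "0 < s" "p * s < 1" "(p / (p - 1) * (1 - s)) powr q - 1 < c * (1 - p * s)"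
proof -
  have "((\<lambda>d. ((1 + p / (p - 1) * d) powr q - 1) / (p * d)) \<longlongrightarrow> q / (p - 1)) (at_right 0)"
    using p q by (real_asymp simp: field_simps)
  then have "\<forall>\<^sub>F d in at_right 0. ((1 + p / (p - 1) * d) powr q - 1) / (p * d) < c"
    using c by (rule order_tendstoD)
  moreover have "\<forall>\<^sub>F d in at_right 0. 0 < d \<and> d < 1 / p"
    using p by (auto simp: eventually_at_right_less intro!: eventually_conj eventually_at_right_real[THEN eventually_mono])
  ultimately have "\<forall>\<^sub>F d in at_right 0. ((1 + p / (p - 1) * d) powr q - 1) / (p * d) < c \<and> 0 < d \<and> d < 1 / p"
    by (rule eventually_conj)
  then obtain d where d: "((1 + p / (p - 1) * d) powr q - 1) / (p * d) < c" "0 < d" "d < 1 / p"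
    using eventually_happens by fastforce
  have eqs: "p / (p - 1) * (1 - (1 / p - d)) = 1 + p / (p - 1) * d" "1 - p * (1 / p - d) = p * d"
    using p by (auto simp: field_simps)
  have "(p / (p - 1) * (1 - (1 / p - d))) powr q - 1 < c * (1 - p * (1 / p - d))"
    unfolding eqs using d p by (simp add: divide_less_eq)
  then show ?thesis using d p
    by (intro that[of "1 / p - d"]) (simp_all add: right_diff_distrib)
qed

text \<open>With \<open>b = 1 - a\<close>, \<open>b' = 1 - a - a\<^sup>2\<close> and
  \<open>g = 1 + s * a\<close>, the ratio \<open>(1 - g * b') / (1 - b')\<close> tends to
  \<open>1 - s\<close> and \<open>(1 - b) / (1 - g powr p * b)\<close> to
  \<open>1 / (1 - p * s)\<close>. The gap between \<open>b'\<close> and \<open>b\<close> is of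
  second order, hence invisible in the limit.\<close>

lemma ex_parameters:
  fixes p q c :: real
  assumes p: "1 < p" and q: "1 \<le> q" and c: "q / (p - 1) < c"
  obtains b' b g where "0 < b'" "b' < b" "b < 1" "1 < g" "g powr p * b < 1"
    "((p / (p - 1)) powr q * ((1 - g * b') / (1 - b')) powr q * g powr (p - q) - 1) * ((1 - b) / (1 - g powr p * b)) < c"
proof -
  obtain s where s: "0 < s" "p * s < 1" "(p / (p - 1) * (1 - s)) powr q - 1 < c * (1 - p * s)"
    using ex_exponent[OF assms] .
  have s1: "s < 1" using s p by (smt (verit) mult_less_cancel_right2)
  have l1: "((\<lambda>a. (1 - (1 + s * a) * (1 - a - a\<^sup>2)) / (1 - (1 - a - a\<^sup>2))) \<longlongrightarrow> 1 - s) (at_right 0)"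
    by real_asymp
  have l2: "((\<lambda>a. (1 + s * a) powr (p - q)) \<longlongrightarrow> 1) (at_right 0)"
    by real_asymp
  have l3: "((\<lambda>a. (1 - (1 - a)) / (1 - (1 + s * a) powr p * (1 - a))) \<longlongrightarrow> 1 / (1 - p * s)) (at_right 0)"
    using s(2) by (real_asymp simp: field_simps)
  have "((\<lambda>a. ((p / (p - 1)) powr q
        * ((1 - (1 + s * a) * (1 - a - a\<^sup>2)) / (1 - (1 - a - a\<^sup>2))) powr q * (1 + s * a) powr (p - q) - 1)
      * ((1 - (1 - a)) / (1 - (1 + s * a) powr p * (1 - a))))
    \<longlongrightarrow> ((p / (p - 1)) powr q * (1 - s) powr q * 1 - 1) * (1 / (1 - p * s))) (at_right 0)"
    by (rule tendsto_mult[OF tendsto_diff[OF tendsto_mult[OF tendsto_mult[OF tendsto_const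
      tendsto_powr[OF l1 tendsto_const]] l2] tendsto_const] l3]) (use s1 in simp)
  moreover have "((p / (p - 1)) powr q * (1 - s) powr q * 1 - 1) * (1 / (1 - p * s)) < c"
    using s s1 p by (simp add: powr_mult[symmetric] field_simps)
  ultimately have "\<forall>\<^sub>F a in at_right 0. ((p / (p - 1)) powr q
        * ((1 - (1 + s * a) * (1 - a - a\<^sup>2)) / (1 - (1 - a - a\<^sup>2))) powr q * (1 + s * a) powr (p - q) - 1)
      * ((1 - (1 - a)) / (1 - (1 + s * a) powr p * (1 - a))) < c"
    by (rule order_tendstoD)
  \<comment> \<open>The numerator is \<open>a > 0\<close>, so positivity of the quotient encodes
    \<open>g powr p * b < 1\<close>.\<close>
  moreover have "\<forall>\<^sub>F a in at_right 0. 0 < (1 - (1 - a)) / (1 - (1 + s * a) powr p * (1 - a))"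
    using s by (intro order_tendstoD(1)[OF l3]) simp
  moreover have "\<forall>\<^sub>F a in at_right (0::real). 0 < 1 - a - a\<^sup>2" by real_asymp
  moreover have "\<forall>\<^sub>F a in at_right (0::real). 0 < a" by real_asymp
  ultimately have "\<forall>\<^sub>F a in at_right 0. ((p / (p - 1)) powr q
        * ((1 - (1 + s * a) * (1 - a - a\<^sup>2)) / (1 - (1 - a - a\<^sup>2))) powr q * (1 + s * a) powr (p - q) - 1)
      * ((1 - (1 - a)) / (1 - (1 + s * a) powr p * (1 - a))) < c
      \<and> 0 < (1 - (1 - a)) / (1 - (1 + s * a) powr p * (1 - a)) \<and> 0 < 1 - a - a\<^sup>2 \<and> 0 < a"
    by (intro eventually_conj)
  then obtain a where a: "((p / (p - 1)) powr q
        * ((1 - (1 + s * a) * (1 - a - a\<^sup>2)) / (1 - (1 - a - a\<^sup>2))) powr q * (1 + s * a) powr (p - q) - 1)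
      * ((1 - (1 - a)) / (1 - (1 + s * a) powr p * (1 - a))) < c"
    "0 < (1 - (1 - a)) / (1 - (1 + s * a) powr p * (1 - a))" "0 < 1 - a - a\<^sup>2" "0 < a"
    using eventually_happens by fastforce
  then have "(1 + s * a) powr p * (1 - a) < 1" by (simp add: zero_less_divide_iff)
  then show ?thesis using s a by (intro that[of "1 - a - a\<^sup>2" "1 - a" "1 + s * a"]) auto
qed

section \<open>The extremal functions\<close>

context measure_tree
begin

text \<open>Greedy choice: at a level so fine that each set has measure at most
  \<open>(b - b') * measure M I\<close>, the subsets of \<open>I\<close> are added one at a time
  until the mass reaches \<open>b' * measure M I\<close>. The last set overshoots by no more than
  the width of the window.\<close>

lemma ex_level_subfamily:
  assumes I: "I \<in> T" and b: "0 < b'" "b' < b" "b' < 1"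
  shows "\<exists>D. (\<exists>m. D \<subseteq> level m) \<and> (\<forall>J\<in>D. J \<subseteq> I)
    \<and> b' * measure M I \<le> measure M (\<Union>D) \<and> measure M (\<Union>D) \<le> b * measure M I"
proof -
  obtain j where j: "I \<in> level j" using I tree_eq by auto
  have eps: "0 < (b - b') * measure M I" using b tree_measure_pos[OF I] by simp
  then have "\<forall>\<^sub>F m in sequentially. (SUP I\<in>level m. emeasure M I) < ennreal ((b - b') * measure M I)"
    using mesh_tendsto_0 by (intro order_tendstoD(2)) auto
  then obtain m where m: "(SUP I\<in>level m. emeasure M I) < ennreal ((b - b') * measure M I)" "j \<le> m"
    unfolding eventually_sequentially by (metis nle_le order_trans)
  have small: "measure M J \<le> (b - b') * measure M I" if "J \<in> level m" for J
  proof -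
    have "emeasure M J \<le> ennreal ((b - b') * measure M I)"
      using m(1) SUP_upper[OF that, of "emeasure M"] by auto
    then show ?thesis using eps by (simp add: emeasure_eq_measure)
  qed
  define L where "L = {J\<in>level m. J \<subseteq> I}"
  have UL: "\<Union>L = I"
  proof (intro equalityI subsetI)
    fix x assume x: "x \<in> I"
    then obtain J where J: "J \<in> level m" "x \<in> J"
      using Union_level tree_subset_space[OF I] by blast
    then have "J \<subseteq> I" using level_nested[OF j J(1) m(2)] x by auto
    then show "x \<in> \<Union>L" using J unfolding L_def by auto
  qed (auto simp: L_def)
  then have "L \<noteq> {}" using tree_measure_pos[OF I] by auto
  moreover have "countable L" using countable_level unfolding L_def by auto
  \<comment> \<open>For finite \<open>L\<close> the enumeration repeats members, which is harmless
    as only unions of initial segments are used.\<close>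
  ultimately have rng: "range (from_nat_into L) = L" by (rule range_from_nat_into)
  have meas: "J \<in> sets M" if "J \<in> L" for J using that level_subset tree_sets unfolding L_def by blast
  define A where "A n = (\<Union>i<n. from_nat_into L i)" for n
  have A_sets: "A n \<in> sets M" for n
    unfolding A_def using meas rng by (intro sets.finite_UN) auto
  have "(\<Union>n. A n) = \<Union>(range (from_nat_into L))" unfolding A_def by auto
  then have "(\<Union>n. A n) = I" using rng UL by simp
  moreover have "incseq A" unfolding A_def by (intro monoI UN_mono) auto
  ultimately have "(\<lambda>n. measure M (A n)) \<longlonglongrightarrow> measure M I"
    using A_sets finite_Lim_measure_incseq[of A] by auto
  moreover have "b' * measure M I < measure M I" using b tree_measure_pos[OF I] by simp
  ultimately have "\<forall>\<^sub>F n in sequentially. b' * measure M I < measure M (A n)"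
    by (rule order_tendstoD)
  then have ex: "\<exists>n. b' * measure M I \<le> measure M (A n)"
    using eventually_happens'[OF sequentially_bot] by (meson less_imp_le)
  define n where "n = (LEAST n. b' * measure M I \<le> measure M (A n))"
  have n: "b' * measure M I \<le> measure M (A n)" using LeastI_ex[OF ex] unfolding n_def .
  have "measure M (A 0) = 0" by (simp add: A_def)
  moreover have "0 < b' * measure M I" using b tree_measure_pos[OF I] by simp
  ultimately have "n \<noteq> 0" using n by (metis not_le)
  then obtain k where k: "n = Suc k" by (cases n) auto
  then have less: "measure M (A k) < b' * measure M I"
    using not_less_Least[of k] unfolding n_def by (metis lessI not_le)
  have ek: "from_nat_into L k \<in> L" using rng by blast
  have "A n = A k \<union> from_nat_into L k" by (auto simp: A_def k lessThan_Suc)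
  then have "measure M (A n) \<le> measure M (A k) + measure M (from_nat_into L k)"
    using A_sets meas[OF ek] by (simp add: measure_Un_le)
  also have "\<dots> \<le> b * measure M I"
    using less small[of "from_nat_into L k"] ek by (simp add: L_def algebra_simps)
  finally have "measure M (A n) \<le> b * measure M I" .
  moreover have "from_nat_into L ` {..<n} \<subseteq> L" using rng by auto
  ultimately show ?thesis using n
    by (intro exI[of _ "from_nat_into L ` {..<n}"]) (auto simp: A_def L_def)
qed

end

text \<open>Having each \<open>G I\<close> inside one level makes it disjoint at once and later
  makes the supremum in the maximal function attained. The condition \<open>g * b < 1\<close> keeps
  \<open>coeff\<close> nonnegative and lets no mass escape into the intersection of the stopping
  sets.\<close>

locale tree_selection = measure_tree +
  fixes G :: "'a set \<Rightarrow> 'a set set" and b' b g f :: real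
  assumes G_level: "I \<in> T \<Longrightarrow> \<exists>m. G I \<subseteq> level m"
    and G_inside: "I \<in> T \<Longrightarrow> J \<in> G I \<Longrightarrow> J \<subseteq> I"
    and G_lower: "I \<in> T \<Longrightarrow> b' * measure M I \<le> measure M (\<Union>(G I))"
    and G_upper: "I \<in> T \<Longrightarrow> measure M (\<Union>(G I)) \<le> b * measure M I"
    and parameters: "0 < b'" "b' < b" "b < 1" "1 < g" "g * b < 1" "0 < f"
begin

definition sel :: "nat \<Rightarrow> 'a set set" where
  "sel = tree_level (space M) G"

definition stop :: "nat \<Rightarrow> 'a set" where
  "stop k = \<Union>(sel k)"

definition core :: "'a set \<Rightarrow> 'a set" where
  "core I = I - \<Union>(G I)"

text \<open>Chosen so that passing from a selected set to its selected subsets multiplies averages by \<open>g\<close>;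
  see \<open>coeff_eq\<close>.\<close>

definition coeff :: "'a set \<Rightarrow> real" where
  "coeff I = (1 - g * (measure M (\<Union>(G I)) / measure M I)) / (1 - measure M (\<Union>(G I)) / measure M I)"

text \<open>At each point at most one term of the supremum is nonzero, since the cores are disjoint.
  This form gives measurability from countability and the value 0 on the intersection of all
  \<open>stop k\<close>.\<close>

definition extremal :: "'a \<Rightarrow> real" where
  "extremal x = enn2real (SUP z\<in>(SIGMA k:UNIV. sel k).
     ennreal (f * g ^ fst z * coeff (snd z)) * indicator (core (snd z)) x)"

section \<open>Geometry of the selected generations\<close>

lemma G_subset: "I \<in> T \<Longrightarrow> G I \<subseteq> T"
  using G_level level_subset by blast

lemma G_countable: "I \<in> T \<Longrightarrow> countable (G I)"
  using G_subset countable_tree countable_subset by blast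

lemma G_disjoint: "I \<in> T \<Longrightarrow> disjoint (G I)"
  using G_level disjoint_level by (meson disjoint_def subsetD)

lemma sel_subset: "sel k \<subseteq> T" and countable_sel: "countable (sel k)"
  using countable_tree_level[of "space M" T G k, OF space_in_tree G_subset G_countable]
  unfolding sel_def by auto

lemma sel_in_tree: "I \<in> sel k \<Longrightarrow> I \<in> T"
  using sel_subset by blast

lemma sel_0 [simp]: "sel 0 = {space M}"
  by (simp add: sel_def)

lemma sel_Suc: "sel (Suc k) = (\<Union>I\<in>sel k. G I)"
  by (simp add: sel_def)

lemma disjoint_sel: "disjoint (sel k)"
  unfolding sel_def by (rule disjoint_tree_level[of _ T])
    (use space_in_tree G_subset G_countable G_disjoint G_inside in blast)+

lemma sel_refines: "J \<in> sel n \<Longrightarrow> m \<le> n \<Longrightarrow> \<exists>I\<in>sel m. J \<subseteq> I"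
  unfolding sel_def by (rule tree_level_refines[of _ T])
    (use space_in_tree G_subset G_countable G_inside in blast)+

lemma in_sets [measurable]: "I \<in> T \<Longrightarrow> I \<in> sets M"
  using tree_sets by auto

lemma G_Union_sets [measurable]: "I \<in> T \<Longrightarrow> \<Union>(G I) \<in> sets M"
  using G_subset G_countable in_sets by (intro sets.countable_Union) blast+

lemma core_sets [measurable]: "I \<in> T \<Longrightarrow> core I \<in> sets M"
  unfolding core_def by auto

lemma stop_sets [measurable]: "stop k \<in> sets M"
  unfolding stop_def using sel_in_tree countable_sel by (intro sets.countable_Union) auto

lemma stop_0: "stop 0 = space M"
  by (simp add: stop_def)

lemma stop_antimono: "j \<le> k \<Longrightarrow> stop k \<subseteq> stop j"
proof (induction k rule: dec_induct)
  case (step n)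
  have "stop (Suc n) \<subseteq> stop n"
    unfolding stop_def sel_Suc using G_inside sel_in_tree by blast
  then show ?case using step by auto
qed auto

text \<open>The other sets of generation \<open>k\<close> are disjoint from \<open>I\<close>, and so
  are the subfamilies selected inside them.\<close>

lemma sel_Int_stop_Suc:
  assumes "I \<in> sel k" shows "I \<inter> stop (Suc k) = \<Union>(G I)"
proof -
  have "I \<inter> K = {}" if "J \<in> sel k" "K \<in> G J" "J \<noteq> I" for J K
    using that assms disjoint_sel G_inside sel_in_tree by (meson disjointD disjoint_iff subsetD)
  then show ?thesis
    unfolding stop_def sel_Suc using assms G_inside sel_in_tree by blast
qed

lemma core_eq: "I \<in> sel k \<Longrightarrow> core I = I - stop (Suc k)"
  using sel_Int_stop_Suc[of I k] unfolding core_def by auto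

lemma core_subset: "I \<in> sel k \<Longrightarrow> core I \<subseteq> stop k - stop (Suc k)"
  using core_eq unfolding stop_def by auto

lemma stop_diff_cases:
  assumes "x \<in> stop k - stop (Suc k)"
  obtains I where "I \<in> sel k" "x \<in> core I"
  using assms core_eq unfolding stop_def by blast

lemma stop_diff_unique:
  assumes "x \<in> stop k - stop (Suc k)" "x \<in> stop j - stop (Suc j)"
  shows "j = k"
proof (rule ccontr)
  assume "j \<noteq> k"
  then consider "Suc j \<le> k" | "Suc k \<le> j" by linarith
  then show False using stop_antimono[of "Suc j" k] stop_antimono[of "Suc k" j] assms by cases auto
qed

lemma ex_stop_diff:
  assumes "x \<in> space M" "x \<notin> stop n"
  shows "\<exists>k<n. x \<in> stop k - stop (Suc k)"
  using assms(2)
proof (induction n)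
  case (Suc n)
  then show ?case by (cases "x \<in> stop n") (auto simp: less_Suc_eq)
qed (use assms stop_0 in auto)

lemma ratio_bounds:
  assumes "I \<in> T"
  shows "b' \<le> measure M (\<Union>(G I)) / measure M I" "measure M (\<Union>(G I)) / measure M I \<le> b"
  using G_lower[OF assms] G_upper[OF assms] tree_measure_pos[OF assms] by (auto simp: field_simps)

text \<open>As a function of the ratio \<open>t\<close>, \<open>coeff\<close> is
  \<open>1 - (g - 1) * t / (1 - t)\<close>, which decreases; its largest value on the window is
  therefore taken at \<open>b'\<close>.\<close>

lemma coeff_bounds:
  assumes "I \<in> T"
  shows "0 \<le> coeff I" "coeff I \<le> 1" "coeff I \<le> (1 - g * b') / (1 - b')"
proof -
  define t where "t = measure M (\<Union>(G I)) / measure M I"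
  have t: "b' \<le> t" "t \<le> b" using ratio_bounds[OF assms] by (auto simp: t_def)
  have c: "coeff I = (1 - g * t) / (1 - t)" by (simp add: coeff_def t_def)
  have "g * t \<le> g * b" using t parameters by (intro mult_left_mono) auto
  then have "0 \<le> 1 - g * t" "0 \<le> 1 - t" using t parameters by linarith+
  then show "0 \<le> coeff I" unfolding c by (rule divide_nonneg_nonneg)
  have "t \<le> g * t" using t parameters by (simp add: mult_le_cancel_right1)
  then show "coeff I \<le> 1" unfolding c using t parameters by (auto simp: divide_le_eq)
  have "(g - 1) * b' \<le> (g - 1) * t" using t parameters by (intro mult_left_mono) auto
  then show "coeff I \<le> (1 - g * b') / (1 - b')"
    unfolding c using t parameters by (auto simp: field_simps)
qed

lemma coeff_eq:
  assumes "I \<in> T"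
  shows "coeff I * measure M (core I) + g * measure M (\<Union>(G I)) = measure M I"
proof -
  define t where "t = measure M (\<Union>(G I)) / measure M I"
  have t: "t < 1" using ratio_bounds[OF assms] parameters by (auto simp: t_def)
  have mG: "measure M (\<Union>(G I)) = t * measure M I" using tree_measure_pos[OF assms] by (simp add: t_def)
  have "measure M (core I) = measure M I - measure M (\<Union>(G I))"
    unfolding core_def using assms G_inside by (intro finite_measure_Diff) auto
  then have "measure M (core I) = (1 - t) * measure M I" unfolding mG by (simp add: algebra_simps)
  then have "coeff I * measure M (core I) = (coeff I * (1 - t)) * measure M I" by simp
  also have "coeff I * (1 - t) = 1 - g * t" using t by (simp add: coeff_def t_def[symmetric])
  finally show ?thesis unfolding mG by (simp add: algebra_simps)
qed

lemma extremal_core: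
  assumes I: "I \<in> sel k" and x: "x \<in> core I"
  shows "extremal x = f * g ^ k * coeff I"
proof -
  have "(SUP z\<in>(SIGMA k:UNIV. sel k). ennreal (f * g ^ fst z * coeff (snd z)) * indicator (core (snd z)) x)
    = ennreal (f * g ^ k * coeff I)"
  proof (rule antisym)
    have "j = k \<and> J = I" if J: "J \<in> sel j" "x \<in> core J" for j J
    proof -
      have "j = k" using stop_diff_unique core_subset I x J by blast
      moreover have "J \<inter> I \<noteq> {}" using J x unfolding core_def by auto
      ultimately show ?thesis using disjoint_sel I J by (meson disjointD)
    qed
    then show "(SUP z\<in>(SIGMA k:UNIV. sel k). ennreal (f * g ^ fst z * coeff (snd z)) * indicator (core (snd z)) x)
      \<le> ennreal (f * g ^ k * coeff I)"
      by (intro SUP_least) (auto simp: indicator_def)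
    have "ennreal (f * g ^ k * coeff I) = ennreal (f * g ^ fst (k, I) * coeff (snd (k, I))) * indicator (core (snd (k, I))) x"
      using x by simp
    also have "\<dots> \<le> (SUP z\<in>(SIGMA k:UNIV. sel k). ennreal (f * g ^ fst z * coeff (snd z)) * indicator (core (snd z)) x)"
      by (rule SUP_upper) (use I in auto)
    finally show "ennreal (f * g ^ k * coeff I)
      \<le> (SUP z\<in>(SIGMA k:UNIV. sel k). ennreal (f * g ^ fst z * coeff (snd z)) * indicator (core (snd z)) x)" .
  qed
  then show ?thesis using coeff_bounds(1)[OF sel_in_tree[OF I]] parameters by (simp add: extremal_def)
qed

lemma extremal_nonneg: "0 \<le> extremal x"
  by (simp add: extremal_def)

lemma extremal_eq_0:
  assumes "\<And>k. x \<in> stop k" shows "extremal x = 0"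
proof -
  have "x \<notin> core I" if "I \<in> sel k" for k I
    using core_subset[OF that] assms by auto
  then have "(SUP z\<in>(SIGMA k:UNIV. sel k). ennreal (f * g ^ fst z * coeff (snd z)) * indicator (core (snd z)) x) \<le> 0"
    by (intro SUP_least) (auto simp: indicator_def)
  then show ?thesis by (simp add: extremal_def)
qed

lemma extremal_measurable [measurable]: "extremal \<in> borel_measurable M"
proof -
  have "(\<lambda>x. SUP z\<in>(SIGMA k:UNIV. sel k). ennreal (f * g ^ fst z * coeff (snd z)) * indicator (core (snd z)) x)
    \<in> borel_measurable M"
    using countable_sel sel_in_tree by (intro borel_measurable_SUP countable_SIGMA) auto
  then show ?thesis unfolding extremal_def by measurable
qed

lemma extremal_le:
  assumes "x \<in> stop k - stop (Suc k)"
  shows "extremal x \<le> (1 - g * b') / (1 - b') * (f * g ^ k)" "extremal x \<le> f * g ^ k"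
proof -
  obtain I where I: "I \<in> sel k" "x \<in> core I" using stop_diff_cases[OF assms] .
  have "0 \<le> f * g ^ k" using parameters by auto
  note c = coeff_bounds[OF sel_in_tree[OF I(1)], THEN mult_right_mono[OF _ this]]
  show "extremal x \<le> (1 - g * b') / (1 - b') * (f * g ^ k)" "extremal x \<le> f * g ^ k"
    using extremal_core[OF I] c by (auto simp: mult_ac)
qed

lemma extremal_le_of_notin_stop:
  assumes "x \<in> space M" "x \<notin> stop n"
  shows "extremal x \<le> f * g ^ n"
proof -
  obtain k where k: "k < n" "x \<in> stop k - stop (Suc k)" using ex_stop_diff[OF assms] by auto
  have "extremal x \<le> f * g ^ k" using extremal_le k by auto
  also have "\<dots> \<le> f * g ^ n" using k parameters by (auto intro!: power_increasing)
  finally show ?thesis .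
qed

text \<open>Summing \<open>G_upper\<close> over the disjoint sets of generation \<open>k\<close>
  costs a factor \<open>b\<close> per generation. The density by an indicator makes the measure of
  the intersection with \<open>stop (Suc k)\<close> a measure to which additivity applies.\<close>

lemma emeasure_stop_le: "emeasure M (stop k) \<le> ennreal (b ^ k)"
proof (induction k)
  case 0
  then show ?case by (simp add: emeasure_le_1)
next
  case (Suc k)
  have "emeasure (density M (indicator (stop (Suc k)))) (\<Union>(sel k)) \<le> ennreal b * emeasure M (\<Union>(sel k))"
  proof (rule emeasure_Union_le_of_disjoint)
    fix I assume I: "I \<in> sel k"
    have "emeasure (density M (indicator (stop (Suc k)))) I = emeasure M (I \<inter> stop (Suc k))"
      using sel_in_tree[OF I] by (subst emeasure_restricted) (auto simp: Int_commute)
    then show "emeasure (density M (indicator (stop (Suc k)))) I \<le> ennreal b * emeasure M I"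
      using G_upper[OF sel_in_tree[OF I]] parameters
      by (simp add: sel_Int_stop_Suc[OF I] emeasure_eq_measure ennreal_mult'[symmetric])
  qed (use countable_sel disjoint_sel sel_in_tree in auto)
  moreover have "emeasure (density M (indicator (stop (Suc k)))) (\<Union>(sel k)) = emeasure M (stop (Suc k))"
    unfolding stop_def[of k, symmetric] using stop_antimono[of k "Suc k"]
    by (subst emeasure_restricted) (auto simp: Int_absorb2)
  ultimately have "emeasure M (stop (Suc k)) \<le> ennreal b * emeasure M (stop k)"
    unfolding stop_def[of k, symmetric] by simp
  also have "\<dots> \<le> ennreal b * ennreal (b ^ k)" using Suc by (rule mult_left_mono) auto
  finally show ?case using parameters by (simp add: ennreal_mult'[symmetric])
qed

lemma stop_Inter_null: "(\<Inter>k. stop k) \<in> null_sets M"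
proof (rule null_setsI)
  have "emeasure M (\<Inter>k. stop k) \<le> ennreal (b ^ k)" for k
    using emeasure_mono[of "\<Inter>k. stop k" "stop k" M] emeasure_stop_le[of k] by (force intro: order_trans)
  moreover have "(\<lambda>k. ennreal (b ^ k)) \<longlonglongrightarrow> ennreal 0"
    using parameters by (intro tendsto_ennrealI LIMSEQ_realpow_zero) auto
  ultimately have "emeasure M (\<Inter>k. stop k) \<le> ennreal 0" by (intro LIMSEQ_le_const) auto
  then show "emeasure M (\<Inter>k. stop k) = 0" by simp
qed auto

lemma AE_stop_diff: "AE x in M. \<exists>k. x \<in> stop k - stop (Suc k)"
  using AE_not_in[OF stop_Inter_null] AE_space
  by eventually_elim (use ex_stop_diff in blast)

text \<open>A nonnegative martingale: the conditional expectations of \<open>extremal\<close> along the generations \<open>sel n\<close>.\<close>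

definition approx :: "nat \<Rightarrow> 'a \<Rightarrow> real" where
  "approx n x = (if x \<in> stop n then f * g ^ n else extremal x)"

lemma approx_measurable [measurable]: "approx n \<in> borel_measurable M"
  unfolding approx_def by measurable

lemma emeasure_density_approx:
  "A \<in> sets M \<Longrightarrow> emeasure (density M (approx n)) A = (\<integral>\<^sup>+x. ennreal (approx n x) * indicator A x \<partial>M)"
  by (rule emeasure_density) auto

text \<open>One martingale step: on \<open>I\<close> the function is
  \<open>f * g ^ n * coeff I\<close> on the core and \<open>f * g ^ Suc n\<close> on the subfamily,
  and \<open>coeff_eq\<close> balances the two masses.\<close>

lemma approx_Suc_sel:
  assumes "I \<in> sel n"
  shows "emeasure (density M (approx (Suc n))) I = ennreal (f * g ^ n) * emeasure M I"
proof -
  have T: "I \<in> T" using assms by (rule sel_in_tree)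
  have c: "0 \<le> coeff I" using coeff_bounds T by auto
  have "emeasure (density M (approx (Suc n))) I
    = (\<integral>\<^sup>+x. ennreal (f * g ^ n * coeff I) * indicator (core I) x + ennreal (f * g ^ Suc n) * indicator (\<Union>(G I)) x \<partial>M)"
    unfolding emeasure_density_approx[OF in_sets[OF T]]
  proof (intro nn_integral_cong)
    fix x
    have "x \<in> core I \<longleftrightarrow> x \<in> I \<and> x \<notin> stop (Suc n)" "x \<in> \<Union>(G I) \<longleftrightarrow> x \<in> I \<and> x \<in> stop (Suc n)"
      using core_eq[OF assms] sel_Int_stop_Suc[OF assms] by auto
    then show "ennreal (approx (Suc n) x) * indicator I x
      = ennreal (f * g ^ n * coeff I) * indicator (core I) x + ennreal (f * g ^ Suc n) * indicator (\<Union>(G I)) x"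
      using extremal_core[OF assms] by (simp add: indicator_def approx_def)
  qed
  also have "\<dots> = ennreal (f * g ^ n * coeff I) * emeasure M (core I) + ennreal (f * g ^ Suc n) * emeasure M (\<Union>(G I))"
    using T by (simp add: nn_integral_add nn_integral_cmult)
  also have "\<dots> = ennreal (f * g ^ n * (coeff I * measure M (core I) + g * measure M (\<Union>(G I))))"
    using c parameters by (simp add: emeasure_eq_measure ennreal_mult'[symmetric] ennreal_plus[symmetric] distrib_left mult_ac del: ennreal_plus)
  also have "\<dots> = ennreal (f * g ^ n) * emeasure M I"
    using parameters by (simp add: coeff_eq[OF T] emeasure_eq_measure ennreal_mult')
  finally show ?thesis .
qed

text \<open>Passing from \<open>n\<close> to \<open>Suc n\<close> changes the function only on
  \<open>stop n\<close>. Inside \<open>I\<close> this set is a disjoint union of sets of generation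
  \<open>n\<close>, each of which keeps its mass by \<open>approx_Suc_sel\<close>.\<close>

lemma emeasure_approx:
  assumes "I \<in> sel j" "j \<le> n"
  shows "emeasure (density M (approx n)) I = ennreal (f * g ^ j) * emeasure M I"
  using assms(2)
proof (induction n rule: dec_induct)
  case base
  have "emeasure (density M (approx j)) I = (\<integral>\<^sup>+x. ennreal (f * g ^ j) * indicator I x \<partial>M)"
    unfolding emeasure_density_approx[OF in_sets[OF sel_in_tree[OF assms(1)]]]
    using assms by (intro nn_integral_cong) (auto simp: approx_def indicator_def stop_def)
  then show ?case using sel_in_tree[OF assms(1)] by (simp add: nn_integral_cmult)
next
  case (step n)
  have [measurable]: "I \<in> sets M" using sel_in_tree[OF assms(1)] by auto
  define D where "D = {K\<in>sel n. K \<subseteq> I}"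
  have sub: "K \<subseteq> I" if K: "K \<in> sel n" "K \<inter> I \<noteq> {}" for K
  proof -
    obtain I' where I': "I' \<in> sel j" "K \<subseteq> I'"
      using sel_refines[OF K(1), of j] step.hyps by blast
    then have "I' \<inter> I \<noteq> {}" using K by auto
    then have "I' = I" using I' assms disjoint_sel by (meson disjointD)
    then show ?thesis using I' by simp
  qed
  have UD: "I \<inter> stop n = \<Union>D" unfolding D_def stop_def using sub by blast
  have "disjoint D" using disjoint_sel[of n] unfolding D_def disjoint_def by blast
  then have D: "countable D" "disjoint D" "D \<subseteq> sets M"
    using countable_sel sel_in_tree unfolding D_def by auto
  have "emeasure (density M (approx (Suc n))) (I \<inter> stop n) = ennreal (f * g ^ n) * emeasure M (I \<inter> stop n)"
    unfolding UD using D approx_Suc_sel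
    by (intro antisym emeasure_Union_le_of_disjoint emeasure_Union_ge_of_disjoint) (auto simp: D_def)
  also have "\<dots> = (\<integral>\<^sup>+x. ennreal (f * g ^ n) * indicator (I \<inter> stop n) x \<partial>M)"
    by (simp add: nn_integral_cmult)
  also have "\<dots> = emeasure (density M (approx n)) (I \<inter> stop n)"
    by (subst emeasure_density_approx) (auto intro!: nn_integral_cong simp: approx_def indicator_def)
  finally have 1: "emeasure (density M (approx (Suc n))) (I \<inter> stop n) = emeasure (density M (approx n)) (I \<inter> stop n)" .
  have 2: "emeasure (density M (approx (Suc n))) (I - stop n) = emeasure (density M (approx n)) (I - stop n)"
    using stop_antimono[of n "Suc n"]
    by (simp add: emeasure_density_approx) (auto intro!: nn_integral_cong simp: approx_def indicator_def)
  have split: "emeasure (density M (approx k)) I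
    = emeasure (density M (approx k)) (I \<inter> stop n) + emeasure (density M (approx k)) (I - stop n)" for k
    by (subst plus_emeasure) (auto simp: Un_Diff_Int Un_commute)
  show ?case using step.IH 1 2 split[of n] split[of "Suc n"] by simp
qed

text \<open>Fatou's lemma gives one inequality. For the other, \<open>approx n\<close> exceeds
  \<open>extremal\<close> by at most \<open>f * g ^ n\<close> and only on \<open>stop n\<close>, so
  the excess mass is at most \<open>f * (g * b) ^ n\<close>, which tends to 0.\<close>

lemma emeasure_extremal:
  assumes I: "I \<in> sel j"
  shows "emeasure (density M extremal) I = ennreal (f * g ^ j) * emeasure M I"
proof (rule antisym)
  have [measurable]: "I \<in> sets M" using sel_in_tree[OF I] by auto
  have ev: "\<forall>\<^sub>F n in sequentially. emeasure (density M (approx n)) I = ennreal (f * g ^ j) * emeasure M I"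
    using emeasure_approx[OF I] eventually_sequentially by blast
  have "emeasure (density M extremal) I = (\<integral>\<^sup>+x. ennreal (extremal x) * indicator I x \<partial>M)"
    by (simp add: emeasure_density)
  also have "\<dots> \<le> (\<integral>\<^sup>+x. liminf (\<lambda>n. ennreal (approx n x) * indicator I x) \<partial>M)"
  proof (intro nn_integral_mono Liminf_bounded)
    fix x assume "x \<in> space M"
    show "\<forall>\<^sub>F n in sequentially. ennreal (extremal x) * indicator I x \<le> ennreal (approx n x) * indicator I x"
    proof (cases "\<forall>k. x \<in> stop k")
      case True
      then show ?thesis using extremal_eq_0 by simp
    next
      case False
      then obtain k where "x \<notin> stop k" by auto
      then have "x \<notin> stop n" if "k \<le> n" for n using stop_antimono[OF that] by auto
      then show ?thesis unfolding eventually_sequentially approx_def by auto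
    qed
  qed
  also have "\<dots> \<le> liminf (\<lambda>n. \<integral>\<^sup>+x. ennreal (approx n x) * indicator I x \<partial>M)"
    by (intro nn_integral_liminf) measurable
  also have "\<dots> = liminf (\<lambda>n. emeasure (density M (approx n)) I)"
    by (simp add: emeasure_density)
  also have "\<dots> = ennreal (f * g ^ j) * emeasure M I"
    using ev by (intro lim_imp_Liminf tendsto_eventually) auto
  finally show "emeasure (density M extremal) I \<le> ennreal (f * g ^ j) * emeasure M I" .
  have "ennreal (f * g ^ j) * emeasure M I \<le> emeasure (density M extremal) I + ennreal (f * (g * b) ^ n)" if "j \<le> n" for n
  proof -
    have "ennreal (f * g ^ j) * emeasure M I = (\<integral>\<^sup>+x. ennreal (approx n x) * indicator I x \<partial>M)"
      using emeasure_approx[OF I that] by (simp add: emeasure_density)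
    also have "\<dots> \<le> (\<integral>\<^sup>+x. ennreal (extremal x) * indicator I x + ennreal (f * g ^ n) * indicator (stop n) x \<partial>M)"
      by (intro nn_integral_mono) (auto simp: approx_def indicator_def)
    also have "\<dots> = emeasure (density M extremal) I + ennreal (f * g ^ n) * emeasure M (stop n)"
      by (simp add: emeasure_density nn_integral_add nn_integral_cmult)
    also have "ennreal (f * g ^ n) * emeasure M (stop n) \<le> ennreal (f * g ^ n) * ennreal (b ^ n)"
      using emeasure_stop_le by (intro mult_left_mono) auto
    also have "\<dots> = ennreal (f * (g * b) ^ n)"
      using parameters by (simp add: ennreal_mult'[symmetric] power_mult_distrib mult.assoc)
    finally show ?thesis by (simp add: add_left_mono)
  qed
  moreover have "(\<lambda>n. emeasure (density M extremal) I + ennreal (f * (g * b) ^ n)) \<longlonglongrightarrow> emeasure (density M extremal) I + ennreal (f * 0)"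
    using parameters by (intro tendsto_intros tendsto_ennrealI LIMSEQ_realpow_zero) auto
  ultimately have "ennreal (f * g ^ j) * emeasure M I \<le> emeasure (density M extremal) I + ennreal (f * 0)"
    by (intro LIMSEQ_le_const) auto
  then show "ennreal (f * g ^ j) * emeasure M I \<le> emeasure (density M extremal) I" by simp
qed

end

section \<open>Averages and maximal function of the extremal function\<close>

context tree_selection
begin

lemma integrable_extremal: "integrable M extremal" and integral_extremal: "(LINT x|M. extremal x) = f"
proof -
  have "(\<integral>\<^sup>+x. ennreal (extremal x) \<partial>M) = emeasure (density M extremal) (space M)"
    by (subst emeasure_density) (auto intro!: nn_integral_cong simp: indicator_def)
  also have "\<dots> = ennreal f"
    using emeasure_extremal[of "space M" 0] by (simp add: emeasure_space_1)
  finally have nn: "(\<integral>\<^sup>+x. ennreal (extremal x) \<partial>M) = ennreal f" .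
  show "integrable M extremal"
    by (rule integrableI_nonneg) (use nn extremal_nonneg in auto)
  show "(LINT x|M. extremal x) = f"
    using nn parameters extremal_nonneg by (subst integral_eq_nn_integral) auto
qed

lemma ennreal_Av_extremal:
  assumes "I \<in> T"
  shows "ennreal (Av M I extremal) * emeasure M I = emeasure (density M extremal) I"
  using ennreal_Av_mult[OF assms integrable_extremal extremal_nonneg] assms
  by (simp add: emeasure_density)

lemma Av_extremal_sel:
  assumes "I \<in> sel k"
  shows "ennreal (Av M I extremal) = ennreal (f * g ^ k)"
proof -
  have "emeasure M I * ennreal (Av M I extremal) = emeasure M I * ennreal (f * g ^ k)"
    using ennreal_Av_extremal[OF sel_in_tree[OF assms]] emeasure_extremal[OF assms] by (simp add: mult.commute)
  moreover have "emeasure M I \<noteq> 0" "emeasure M I \<noteq> top"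
    using tree_pos[OF sel_in_tree[OF assms]] by auto
  ultimately show ?thesis by (simp add: ennreal_mult_cancel_left)
qed

text \<open>Since \<open>J\<close> contains a point outside \<open>stop (Suc k)\<close>, it lies in
  no set of generation \<open>Suc k\<close>; by nesting, those meeting \<open>J\<close> lie inside
  it and have average \<open>f * g ^ Suc k\<close>. On the rest of \<open>J\<close> the function
  itself is at most that value.\<close>

lemma Av_extremal_le:
  assumes J: "J \<in> T" and x: "x \<in> J" "x \<in> stop k - stop (Suc k)"
  shows "ennreal (Av M J extremal) \<le> ennreal (f * g ^ Suc k)"
proof -
  let ?N = "density M extremal" and ?v = "ennreal (f * g ^ Suc k)"
  have [measurable]: "J \<in> sets M" using J by auto
  define D where "D = {K\<in>sel (Suc k). K \<subseteq> J}"
  have sub: "K \<subseteq> J" if K: "K \<in> sel (Suc k)" "K \<inter> J \<noteq> {}" for K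
  proof -
    have "\<not> J \<subseteq> K" using x K unfolding stop_def by blast
    then show ?thesis using tree_nested[OF sel_in_tree[OF K(1)] J K(2)] by blast
  qed
  have UD: "J \<inter> stop (Suc k) = \<Union>D" unfolding D_def stop_def using sub by blast
  have "disjoint D" using disjoint_sel[of "Suc k"] unfolding D_def disjoint_def by blast
  then have D: "countable D" "disjoint D" "D \<subseteq> sets M"
    using countable_sel sel_in_tree unfolding D_def by auto
  have 1: "emeasure ?N (J \<inter> stop (Suc k)) \<le> ?v * emeasure M (J \<inter> stop (Suc k))"
    unfolding UD using D emeasure_extremal
    by (intro emeasure_Union_le_of_disjoint) (auto simp: D_def)
  have "emeasure ?N (J - stop (Suc k)) = (\<integral>\<^sup>+x. ennreal (extremal x) * indicator (J - stop (Suc k)) x \<partial>M)"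
    by (rule emeasure_density) auto
  also have "\<dots> \<le> (\<integral>\<^sup>+x. ?v * indicator (J - stop (Suc k)) x \<partial>M)"
    using extremal_le_of_notin_stop[of _ "Suc k"]
    by (intro nn_integral_mono) (auto simp: indicator_def intro!: ennreal_leI)
  also have "\<dots> = ?v * emeasure M (J - stop (Suc k))" by (rule nn_integral_cmult_indicator) auto
  finally have 2: "emeasure ?N (J - stop (Suc k)) \<le> ?v * emeasure M (J - stop (Suc k))" .
  have "emeasure ?N J = emeasure ?N (J \<inter> stop (Suc k)) + emeasure ?N (J - stop (Suc k))"
    by (subst plus_emeasure) (auto simp: Un_Diff_Int Un_commute)
  also have "\<dots> \<le> ?v * emeasure M (J \<inter> stop (Suc k)) + ?v * emeasure M (J - stop (Suc k))"
    using 1 2 by (rule add_mono)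
  also have "\<dots> = ?v * (emeasure M (J \<inter> stop (Suc k)) + emeasure M (J - stop (Suc k)))"
    by (simp only: distrib_left)
  also have "emeasure M (J \<inter> stop (Suc k)) + emeasure M (J - stop (Suc k)) = emeasure M J"
    by (subst plus_emeasure) (auto simp: Un_Diff_Int Un_commute)
  finally have "emeasure M J * ennreal (Av M J extremal) \<le> emeasure M J * ?v"
    using ennreal_Av_extremal[OF J] by (simp add: mult.commute)
  moreover have "emeasure M J \<noteq> 0" "emeasure M J \<noteq> top" using tree_pos[OF J] by auto
  ultimately show ?thesis by (simp add: ennreal_mult_le_mult_iff)
qed

lemma maximal_op_extremal_eq: "maximal_op M T extremal x = (SUP I\<in>{I\<in>T. x \<in> I}. ennreal (Av M I extremal))"
  using extremal_nonneg by (simp add: maximal_op_def)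

text \<open>Arbitrary tree sets between two generations may have averages above
  \<open>f * g ^ k\<close>, so the maximal function is located only up to the factor
  \<open>g\<close>. This suffices because \<open>g\<close> tends to 1.\<close>

lemma maximal_op_extremal_bounds:
  assumes x: "x \<in> stop k - stop (Suc k)"
  shows "ennreal (f * g ^ k) \<le> maximal_op M T extremal x"
    and "maximal_op M T extremal x \<le> ennreal (f * g ^ Suc k)"
proof -
  obtain I where I: "I \<in> sel k" "x \<in> I" using x unfolding stop_def by auto
  show "ennreal (f * g ^ k) \<le> maximal_op M T extremal x"
    using Av_le_maximal_op[where \<phi>=extremal, OF sel_in_tree[OF I(1)] I(2) extremal_nonneg] Av_extremal_sel[OF I(1)] by simp
  show "maximal_op M T extremal x \<le> ennreal (f * g ^ Suc k)"
    unfolding maximal_op_extremal_eq using Av_extremal_le[OF _ _ x] by (intro SUP_least) auto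
qed

lemma Av_const_on:
  assumes "J \<in> T" "\<And>x. x \<in> J \<Longrightarrow> \<phi> x = c"
  shows "Av M J \<phi> = c"
proof -
  have "(LINT x:J|M. \<phi> x) = (LINT x|M. indicator J x * c)"
    unfolding set_lebesgue_integral_def using assms
    by (intro Bochner_Integration.integral_cong) (auto simp: indicator_def)
  then show ?thesis using assms tree_measure_pos[OF assms(1)] by (simp add: Av_def)
qed

text \<open>From level \<open>N\<close> on, a tree set around \<open>x\<close> lies in
  \<open>K\<close> and misses \<open>G K\<close>, so it lies in the core, where the function is
  constant. Each earlier level has just one set around \<open>x\<close>; the supremum is thus over
  finitely many values.\<close>

lemma maximal_op_extremal_attained:
  assumes x: "x \<in> stop k - stop (Suc k)"
  shows "\<exists>I\<in>T. x \<in> I \<and> maximal_op M T extremal x = ennreal (Av M I extremal)"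
proof -
  obtain K where K: "K \<in> sel k" "x \<in> core K" using stop_diff_cases[OF x] .
  have KT: "K \<in> T" using K by (auto intro: sel_in_tree)
  then have xs: "x \<in> space M" using K tree_subset_space unfolding core_def by auto
  obtain j m where j: "K \<in> level j" and m: "G K \<subseteq> level m" using KT tree_eq G_level by blast
  define N where "N = max j m"
  have deep: "Av M J extremal = f * g ^ k * coeff K" if J: "J \<in> level n" "x \<in> J" "N \<le> n" for J n
  proof -
    have "J \<subseteq> K" using level_nested[OF j J(1)] J K unfolding N_def core_def by auto
    moreover have "L \<inter> J = {}" if "L \<in> G K" for L
      using level_nested[of L m J n] that m J K unfolding N_def core_def by auto
    ultimately have "J \<subseteq> core K" unfolding core_def by blast
    then show ?thesis using extremal_core[OF K(1)] J level_subset by (intro Av_const_on) auto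
  qed
  have "finite {I\<in>level n. x \<in> I}" for n
  proof -
    obtain I where I: "I \<in> level n" "x \<in> I" using Union_level xs by blast
    have "{I\<in>level n. x \<in> I} \<subseteq> {I}" using disjoint_level[of n] I by (auto dest: disjointD)
    then show ?thesis by (rule finite_subset) simp
  qed
  moreover have "(\<lambda>I. ennreal (Av M I extremal)) ` {I\<in>T. x \<in> I}
    \<subseteq> insert (ennreal (f * g ^ k * coeff K)) ((\<lambda>I. ennreal (Av M I extremal)) ` (\<Union>n<N. {I\<in>level n. x \<in> I}))"
  proof (rule image_subsetI)
    fix J assume "J \<in> {I\<in>T. x \<in> I}"
    then obtain n where n: "J \<in> level n" "x \<in> J" using tree_eq by auto
    then show "ennreal (Av M J extremal) \<in> insert (ennreal (f * g ^ k * coeff K))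
        ((\<lambda>I. ennreal (Av M I extremal)) ` (\<Union>n<N. {I\<in>level n. x \<in> I}))"
      using deep[of J n] by (cases "n < N") auto
  qed
  ultimately have "finite ((\<lambda>I. ennreal (Av M I extremal)) ` {I\<in>T. x \<in> I})"
    by (meson finite_UN_I finite_imageI finite_insert finite_lessThan finite_subset)
  moreover have "{I\<in>T. x \<in> I} \<noteq> {}" using space_in_tree xs by auto
  ultimately have "Sup ((\<lambda>I. ennreal (Av M I extremal)) ` {I\<in>T. x \<in> I}) \<in> (\<lambda>I. ennreal (Av M I extremal)) ` {I\<in>T. x \<in> I}"
    by (subst cSup_eq_Max) (auto intro!: Max_in simp del: Max_in)
  then show ?thesis unfolding maximal_op_extremal_eq by auto
qed

lemma tree_good_extremal: "tree_good M T extremal"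
  unfolding tree_good_def
proof (intro conjI ballI integrable_extremal extremal_nonneg)
  let ?B = "{x\<in>space M. \<forall>I\<in>T. x \<in> I \<longrightarrow> ennreal (Av M I extremal) < maximal_op M T extremal x}"
  have "?B \<subseteq> (\<Inter>k. stop k)"
  proof (intro subsetI INT_I)
    fix x k assume x: "x \<in> ?B"
    show "x \<in> stop k"
    proof (rule ccontr)
      assume "x \<notin> stop k"
      then obtain n where "x \<in> stop n - stop (Suc n)" using ex_stop_diff x by blast
      then obtain I where "I \<in> T" "x \<in> I" "maximal_op M T extremal x = ennreal (Av M I extremal)"
        using maximal_op_extremal_attained by blast
      then show False using x by auto
    qed
  qed
  \<comment> \<open>\<open>M\<close> need not be complete, so inclusion in a null set does not give
    measurability.\<close>
  moreover have "?B \<in> sets M"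
  proof -
    have "?B = (\<Inter>I\<in>T. {x\<in>space M. x \<in> I \<longrightarrow> ennreal (Av M I extremal) < maximal_op M T extremal x})"
      using space_in_tree by blast
    moreover have "\<dots> \<in> sets M"
      using countable_tree space_in_tree by (intro sets.countable_INT') auto
    ultimately show ?thesis by simp
  qed
  ultimately show "?B \<in> null_sets M" using stop_Inter_null null_sets_subset by blast
qed

section \<open>Power integrals and failure of the inequality for larger constants\<close>

text \<open>The sum telescopes, so on \<open>stop k - stop (Suc k)\<close> this is \<open>(f * g ^ k) powr p\<close>, which is within the
  factor \<open>g powr p\<close> of the \<open>p\<close>-th power of the maximal function.\<close>

definition power_weight :: "real \<Rightarrow> 'a \<Rightarrow> ennreal" where
  "power_weight p x = ennreal (f powr p)
    * (1 + (\<Sum>k. ennreal ((g powr p) ^ Suc k - (g powr p) ^ k) * indicator (stop (Suc k)) x))"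

lemma power_weight_measurable [measurable]: "power_weight p \<in> borel_measurable M"
  unfolding power_weight_def by measurable

lemma power_weight_eq:
  assumes x: "x \<in> stop k - stop (Suc k)" and p: "0 \<le> p"
  shows "power_weight p x = ennreal ((f * g ^ k) powr p)"
proof -
  define h where "h = g powr p"
  have h: "1 \<le> h" unfolding h_def using parameters p by (simp add: ge_one_powr_ge_zero)
  have ind: "indicator (stop (Suc i)) x = (if i < k then 1 else 0 :: ennreal)" for i
    using x stop_antimono[of "Suc i" k] stop_antimono[of "Suc k" "Suc i"] by (auto simp: indicator_def)
  have "(\<Sum>i. ennreal (h ^ Suc i - h ^ i) * indicator (stop (Suc i)) x) = (\<Sum>i<k. ennreal (h ^ Suc i - h ^ i))"
    by (subst suminf_finite[of "{..<k}"]) (auto simp: ind)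
  also have "\<dots> = ennreal (\<Sum>i<k. h ^ Suc i - h ^ i)"
    using h by (intro sum_ennreal) (simp add: mult_le_cancel_right1)
  also have "(\<Sum>i<k. h ^ Suc i - h ^ i) = h ^ k - 1" by (subst sum_lessThan_telescope) simp
  finally have "power_weight p x = ennreal (f powr p) * (1 + ennreal (h ^ k - 1))"
    by (simp only: power_weight_def h_def)
  also have "1 + ennreal (h ^ k - 1) = ennreal (h ^ k)"
    using h by (simp add: one_le_power ennreal_plus[symmetric] ennreal_1[symmetric] del: ennreal_plus ennreal_1)
  also have "h ^ k = (g ^ k) powr p"
    using parameters unfolding h_def
    by (simp add: powr_realpow[symmetric] powr_powr mult.commute)
  finally show ?thesis using parameters by (simp add: ennreal_mult'[symmetric] powr_mult)
qed

text \<open>Abel summation: the telescoped form has nonnegative coefficients, so the upper bounds on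
  \<open>stop (Suc k)\<close> can be inserted. Bounding each layer
  \<open>stop k - stop (Suc k)\<close> by \<open>b ^ k\<close> instead would lose the decisive
  factor \<open>1 - b\<close>.\<close>

lemma nn_integral_power_weight_le:
  assumes p: "0 \<le> p" and hb: "g powr p * b < 1"
  shows "(\<integral>\<^sup>+x. power_weight p x \<partial>M) \<le> ennreal (f powr p * ((1 - b) / (1 - g powr p * b)))"
proof -
  define h where "h = g powr p"
  have h: "1 \<le> h" unfolding h_def using parameters p by (simp add: ge_one_powr_ge_zero)
  have b: "0 < b" using parameters by simp
  have "(\<integral>\<^sup>+x. (\<Sum>k. ennreal (h ^ Suc k - h ^ k) * indicator (stop (Suc k)) x) \<partial>M)
    = (\<Sum>k. \<integral>\<^sup>+x. ennreal (h ^ Suc k - h ^ k) * indicator (stop (Suc k)) x \<partial>M)"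
    by (rule nn_integral_suminf) measurable
  also have "\<dots> = (\<Sum>k. ennreal (h ^ Suc k - h ^ k) * emeasure M (stop (Suc k)))"
    by (simp add: nn_integral_cmult)
  also have "\<dots> \<le> (\<Sum>k. ennreal ((h - 1) * b * (h * b) ^ k))"
  proof (intro suminf_le)
    fix k
    have "ennreal (h ^ Suc k - h ^ k) * emeasure M (stop (Suc k)) \<le> ennreal (h ^ Suc k - h ^ k) * ennreal (b ^ Suc k)"
      by (intro mult_left_mono emeasure_stop_le) auto
    also have "\<dots> = ennreal ((h - 1) * b * (h * b) ^ k)"
      using b by (subst ennreal_mult''[symmetric]) (simp_all add: power_mult_distrib algebra_simps)
    finally show "ennreal (h ^ Suc k - h ^ k) * emeasure M (stop (Suc k)) \<le> ennreal ((h - 1) * b * (h * b) ^ k)" .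
  qed auto
  also have "\<dots> = ennreal ((h - 1) * b * (1 / (1 - h * b)))"
    using h b hb by (intro suminf_ennreal_eq sums_mult geometric_sums) (auto simp: h_def)
  finally have S: "(\<integral>\<^sup>+x. (\<Sum>k. ennreal (h ^ Suc k - h ^ k) * indicator (stop (Suc k)) x) \<partial>M)
    \<le> ennreal ((h - 1) * b * (1 / (1 - h * b)))" .
  have "(\<integral>\<^sup>+x. power_weight p x \<partial>M) = ennreal (f powr p)
    * (1 + (\<integral>\<^sup>+x. (\<Sum>k. ennreal (h ^ Suc k - h ^ k) * indicator (stop (Suc k)) x) \<partial>M))"
    unfolding power_weight_def h_def[symmetric]
    by (subst nn_integral_cmult, measurable, subst nn_integral_add) (auto simp: emeasure_space_1)
  also have "\<dots> \<le> ennreal (f powr p) * (1 + ennreal ((h - 1) * b * (1 / (1 - h * b))))"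
    using S by (intro mult_left_mono add_left_mono) auto
  also have "\<dots> = ennreal (f powr p) * ennreal (1 + (h - 1) * b * (1 / (1 - h * b)))"
    using h b hb by (subst ennreal_plus) (auto simp: h_def)
  also have "1 + (h - 1) * b * (1 / (1 - h * b)) = (1 - b) / (1 - h * b)"
    using hb by (simp add: h_def field_simps)
  finally show ?thesis by (simp only: ennreal_mult' powr_ge_zero h_def)
qed

text \<open>Both integrals are compared with the integral \<open>S\<close> of
  \<open>power_weight p\<close>: the left one is at least \<open>S\<close>, the mixed one at most
  \<open>\<rho> * S\<close>. The inequality would force
  \<open>c * f powr p \<le> (K * \<rho> - 1) * S\<close>, so an upper bound on \<open>S\<close> is
  what contradicts it.\<close>

lemma extremal_violates:
  assumes p: "1 < p" and q: "1 \<le> q" "q \<le> p" and hb: "g powr p * b < 1" and c: "0 < c"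
    and viol: "((p / (p - 1)) powr q * ((1 - g * b') / (1 - b')) powr q * g powr (p - q) - 1)
      * ((1 - b) / (1 - g powr p * b)) < c"
  shows "\<not> (enn2ereal (\<integral>\<^sup>+x. ennreal_rpow (maximal_op M T extremal x) p \<partial>M)
      \<le> - ereal (c * f powr p) + ereal ((p / (p - 1)) powr q)
        * enn2ereal (\<integral>\<^sup>+x. ennreal (extremal x powr q) * ennreal_rpow (maximal_op M T extremal x) (p - q) \<partial>M))"
    (is "\<not> (enn2ereal ?L \<le> _ + _ * enn2ereal ?R)")
proof
  define r where "r = (1 - g * b') / (1 - b')"
  define K where "K = (p / (p - 1)) powr q"
  \<comment> \<open>The factor \<open>r powr q\<close> comes from the bound of
    \<open>extremal\<close> by \<open>r * (f * g ^ k)\<close>, the factor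
    \<open>g powr (p - q)\<close> from the slack \<open>g\<close> in the upper bound on the maximal
    function.\<close>
  define \<rho> where "\<rho> = r powr q * g powr (p - q)"
  have K: "0 \<le> K" and \<rho>: "0 \<le> \<rho>" by (auto simp: K_def \<rho>_def)
  have r: "0 \<le> r"
    unfolding r_def using coeff_bounds(1,3)[OF space_in_tree] by linarith
  have v: "0 < f * g ^ k" for k using parameters by simp
  have "(\<integral>\<^sup>+x. power_weight p x \<partial>M) < top"
    using nn_integral_power_weight_le[OF _ hb] p by (auto simp: less_top[symmetric] top_unique)
  then obtain S where S: "(\<integral>\<^sup>+x. power_weight p x \<partial>M) = ennreal S" "0 \<le> S"
    by (cases "\<integral>\<^sup>+x. power_weight p x \<partial>M") auto
  have "ennreal S \<le> ennreal (f powr p * ((1 - b) / (1 - g powr p * b)))"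
    using nn_integral_power_weight_le[OF _ hb] p S(1) by auto
  moreover have "0 \<le> f powr p * ((1 - b) / (1 - g powr p * b))" using parameters hb by simp
  ultimately have S_le: "S \<le> f powr p * ((1 - b) / (1 - g powr p * b))" by (rule le_of_ennreal_le)
  have lower: "ennreal S \<le> ?L"
    unfolding S(1)[symmetric]
  proof (rule nn_integral_mono_AE)
    show "AE x in M. power_weight p x \<le> ennreal_rpow (maximal_op M T extremal x) p"
      using AE_stop_diff
    proof eventually_elim
      fix x assume "\<exists>k. x \<in> stop k - stop (Suc k)"
      then obtain k where k: "x \<in> stop k - stop (Suc k)" by blast
      have "power_weight p x = ennreal_rpow (ennreal (f * g ^ k)) p"
        using power_weight_eq[OF k] p v by (simp add: ennreal_rpow_ennreal)
      also have "\<dots> \<le> ennreal_rpow (maximal_op M T extremal x) p"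
        using maximal_op_extremal_bounds(1)[OF k] p by (intro ennreal_rpow_mono) auto
      finally show "power_weight p x \<le> ennreal_rpow (maximal_op M T extremal x) p" .
    qed
  qed
  have "?R \<le> (\<integral>\<^sup>+x. ennreal \<rho> * power_weight p x \<partial>M)"
  proof (rule nn_integral_mono_AE)
    show "AE x in M. ennreal (extremal x powr q) * ennreal_rpow (maximal_op M T extremal x) (p - q)
      \<le> ennreal \<rho> * power_weight p x"
      using AE_stop_diff
    proof eventually_elim
      fix x assume "\<exists>k. x \<in> stop k - stop (Suc k)"
      then obtain k where k: "x \<in> stop k - stop (Suc k)" by blast
      have "extremal x powr q \<le> (r * (f * g ^ k)) powr q"
        using extremal_le(1)[OF k] extremal_nonneg q by (intro powr_mono2) (auto simp: r_def)
      moreover have "ennreal_rpow (maximal_op M T extremal x) (p - q) \<le> ennreal_rpow (ennreal (f * g ^ Suc k)) (p - q)"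
        using maximal_op_extremal_bounds(2)[OF k] q by (intro ennreal_rpow_mono) auto
      ultimately have "ennreal (extremal x powr q) * ennreal_rpow (maximal_op M T extremal x) (p - q)
        \<le> ennreal ((r * (f * g ^ k)) powr q) * ennreal ((f * g ^ Suc k) powr (p - q))"
        using v by (intro mult_mono ennreal_leI) (simp_all only: ennreal_rpow_ennreal zero_le)
      also have "\<dots> = ennreal ((r * (f * g ^ k)) powr q * (g * (f * g ^ k)) powr (p - q))"
        by (simp add: ennreal_mult'[symmetric] mult_ac)
      also have "(r * (f * g ^ k)) powr q * (g * (f * g ^ k)) powr (p - q)
        = \<rho> * ((f * g ^ k) powr q * (f * g ^ k) powr (p - q))"
        using r parameters v[of k] unfolding \<rho>_def
        by (subst powr_mult, simp, subst powr_mult) (simp_all only: mult_ac less_imp_le)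
      also have "(f * g ^ k) powr q * (f * g ^ k) powr (p - q) = (f * g ^ k) powr p"
        by (simp add: powr_add[symmetric])
      also have "ennreal (\<rho> * (f * g ^ k) powr p) = ennreal \<rho> * power_weight p x"
        using power_weight_eq[OF k] p \<rho> by (simp add: ennreal_mult')
      finally show "ennreal (extremal x powr q) * ennreal_rpow (maximal_op M T extremal x) (p - q)
        \<le> ennreal \<rho> * power_weight p x" .
    qed
  qed
  also have "\<dots> = ennreal (\<rho> * S)"
    using S \<rho> by (simp add: nn_integral_cmult ennreal_mult')
  finally have upper: "?R \<le> ennreal (\<rho> * S)" .
  assume "enn2ereal ?L \<le> - ereal (c * f powr p) + ereal ((p / (p - 1)) powr q) * enn2ereal ?R"
  moreover have "ereal S \<le> enn2ereal ?L"
    using lower S by (simp add: less_eq_ennreal.rep_eq enn2ereal_ennreal)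
  moreover have "enn2ereal ?R \<le> ereal (\<rho> * S)"
    using upper S \<rho> by (simp add: less_eq_ennreal.rep_eq enn2ereal_ennreal)
  then have "ereal K * enn2ereal ?R \<le> ereal K * ereal (\<rho> * S)"
    using K by (intro ereal_mult_left_mono) auto
  ultimately have "ereal S \<le> - ereal (c * f powr p) + ereal K * ereal (\<rho> * S)"
    unfolding K_def by (meson add_left_mono order_trans)
  then have "S \<le> - (c * f powr p) + K * (\<rho> * S)" by simp
  then have ge: "c * f powr p \<le> (K * \<rho> - 1) * S" by (simp add: algebra_simps)
  have fp: "0 < f powr p" using parameters by simp
  show False
  \<comment> \<open>The upper bound on \<open>S\<close> helps only when its coefficient is positive;
    otherwise a positive quantity would be at most 0.\<close>
  proof (cases "K * \<rho> \<le> 1")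
    case True
    then have "(K * \<rho> - 1) * S \<le> 0" using S by (intro mult_nonpos_nonneg) auto
    moreover have "0 < c * f powr p" using c fp by simp
    ultimately show False using ge by linarith
  next
    case False
    then have "(K * \<rho> - 1) * S \<le> (K * \<rho> - 1) * (f powr p * ((1 - b) / (1 - g powr p * b)))"
      using S_le by (intro mult_left_mono) auto
    also have "\<dots> = ((K * \<rho> - 1) * ((1 - b) / (1 - g powr p * b))) * f powr p" by (simp only: mult_ac)
    also have "\<dots> < c * f powr p"
      using viol fp unfolding K_def \<rho>_def r_def by (intro mult_strict_right_mono) (simp_all only: mult_ac)
    finally show False using ge by linarith
  qed
qed

end

theorem theorem1:
  fixes M :: "'a measure" and T :: "'a set set" and p :: real
  assumes "prob_space M" and "non_atomic M" and "is_tree M T" and "p > 1"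
  shows
    "(\<forall>(\<phi> :: 'a \<Rightarrow> real) (f :: real). tree_good M T \<phi> \<and> (LINT x|M. \<phi> x) = f \<longrightarrow>
        (\<forall>q\<in>{1..p}.
           enn2ereal (\<integral>\<^sup>+x. ennreal_rpow (maximal_op M T \<phi> x) p \<partial>M)
           \<le> - ereal (q / (p - 1) * f powr p)
             + ereal ((p / (p - 1)) powr q)
               * enn2ereal (\<integral>\<^sup>+x. ennreal (\<phi> x powr q)
                                 * ennreal_rpow (maximal_op M T \<phi> x) (p - q) \<partial>M)))
     \<and>
     (\<forall>q\<in>{1..p}. \<forall>f::real. f > 0 \<longrightarrow> (\<forall>c::real. c > q / (p - 1) \<longrightarrow>
        (\<exists>\<phi> :: 'a \<Rightarrow> real. tree_good M T \<phi> \<and> (LINT x|M. \<phi> x) = f \<and>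
           \<not> (enn2ereal (\<integral>\<^sup>+x. ennreal_rpow (maximal_op M T \<phi> x) p \<partial>M)
              \<le> - ereal (c * f powr p)
                + ereal ((p / (p - 1)) powr q)
                  * enn2ereal (\<integral>\<^sup>+x. ennreal (\<phi> x powr q)
                                    * ennreal_rpow (maximal_op M T \<phi> x) (p - q) \<partial>M)))))"
proof (intro conjI allI ballI impI)
  obtain C where "measure_tree M T C" using is_tree_imp_measure_tree[OF assms(1,3)] .
  then interpret measure_tree M T C .
  fix \<phi> :: "'a \<Rightarrow> real" and f q :: real
  assume "tree_good M T \<phi> \<and> (LINT x|M. \<phi> x) = f" "q \<in> {1..p}"
  then show "enn2ereal (\<integral>\<^sup>+x. ennreal_rpow (maximal_op M T \<phi> x) p \<partial>M)
           \<le> - ereal (q / (p - 1) * f powr p)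
             + ereal ((p / (p - 1)) powr q)
               * enn2ereal (\<integral>\<^sup>+x. ennreal (\<phi> x powr q)
                                 * ennreal_rpow (maximal_op M T \<phi> x) (p - q) \<partial>M)"
    using \<open>p > 1\<close> by (intro nn_integral_maximal_op_le) (auto simp: tree_good_def)
next
  obtain C where "measure_tree M T C" using is_tree_imp_measure_tree[OF assms(1,3)] .
  then interpret measure_tree M T C .
  fix q f c :: real
  assume q: "q \<in> {1..p}" and f: "f > 0" and c: "c > q / (p - 1)"
  obtain b' b g where par: "0 < b'" "b' < b" "b < 1" "1 < g" "g powr p * b < 1"
    "((p / (p - 1)) powr q * ((1 - g * b') / (1 - b')) powr q * g powr (p - q) - 1)
      * ((1 - b) / (1 - g powr p * b)) < c"
    using ex_parameters[of p q c] \<open>p > 1\<close> q c by auto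
  \<comment> \<open>The condition for a finite power integral implies \<open>g * b < 1\<close>, the
    one needed for the mean of the extremal function to be \<open>f\<close>.\<close>
  have "g powr 1 \<le> g powr p" using par \<open>p > 1\<close> by (intro powr_mono) auto
  then have "g * b \<le> g powr p * b" using par by (intro mult_right_mono) auto
  then have gb: "g * b < 1" using par by linarith
  have "\<forall>I\<in>T. \<exists>D. (\<exists>m. D \<subseteq> level m) \<and> (\<forall>J\<in>D. J \<subseteq> I)
    \<and> b' * measure M I \<le> measure M (\<Union>D) \<and> measure M (\<Union>D) \<le> b * measure M I"
    using ex_level_subfamily par by simp
  then obtain G where G: "\<forall>I\<in>T. (\<exists>m. G I \<subseteq> level m) \<and> (\<forall>J\<in>G I. J \<subseteq> I)
    \<and> b' * measure M I \<le> measure M (\<Union>(G I)) \<and> measure M (\<Union>(G I)) \<le> b * measure M I"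
    by (rule bchoice[THEN exE])
  interpret tree_selection M T C G b' b g f
    by unfold_locales (use G par gb f in blast)+
  have "0 < q / (p - 1)" using q \<open>p > 1\<close> by simp
  then have "0 < c" using c by linarith
  then show "\<exists>\<phi> :: 'a \<Rightarrow> real. tree_good M T \<phi> \<and> (LINT x|M. \<phi> x) = f \<and>
           \<not> (enn2ereal (\<integral>\<^sup>+x. ennreal_rpow (maximal_op M T \<phi> x) p \<partial>M)
              \<le> - ereal (c * f powr p)
                + ereal ((p / (p - 1)) powr q)
                  * enn2ereal (\<integral>\<^sup>+x. ennreal (\<phi> x powr q)
                                    * ennreal_rpow (maximal_op M T \<phi> x) (p - q) \<partial>M))"
    using tree_good_extremal integral_extremal extremal_violates[of p q c] par q \<open>p > 1\<close> by auto
qed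

end
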